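(* Let $X$ be a super-reflexive Banach space, $E\subset X$, and let $f$ be a real function on $E$. Consider the following statements: (i) $f$ is bounded and satisfies condition $(\mathrm W_G)$ for some bounded $G\colon E\to X^*$. (ii) $f$ is Lipschitz and satisfies condition $(\mathrm W_G)$ for some bounded $G\colon E\to X^*$. (iii) $f$ can be extended to a Lipschitz function $F\in C^{1,+}(X)$. (iv) $f$ can be extended to a function $F\in C^{1,+}(X)$. Then (i)$\Rightarrow$(ii)$\Leftrightarrow$(iii)$\Rightarrow$(iv). If $E$ is bounded, then all four statements are equivalent. Moreover, if (i) or (ii) holds with a mapping $G$, then the extension $F$ in (iii) and (iv) can be found such that $DF(x)=G(x)$ for each $x\in E$.
   Context: All normed linear spaces are real; $\langle g,x\rangle=g(x)$ for $g\in X^*$, $x\in X$, and $DF$ denotes the Fréchet derivative of $F$. For an open subset $U$ of a normed linear space, $C^{1,+}(U)$ is the set of all Fréchet differentiable $f\colon U\to\mathbb R$ such that $Df$ is uniformly continuous on $U$. For $E\subset X$, $f\colon E\to\mathbb R$ and $G\colon E\to X^*$, we say that $f$ satisfies condition $(\mathrm W_G)$ if $G$ is uniformly continuous and for each $\varepsilon>0$ there exists $\delta>0$ such that $|f(y)-f(x)-\langle G(x),y-x\rangle|\le\varepsilon\|y-x\|$ whenever $x,y\in E$ and $\|y-x\|<\delta$. A Banach space is super-reflexive if and only if it has an equivalent uniformly smooth norm. *)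

theory Defs
  imports "HOL-Analysis.Analysis"
begin

definition equivalent_norm :: "('a::real_normed_vector \<Rightarrow> real) \<Rightarrow> bool" where
  "equivalent_norm N \<longleftrightarrow>
     (\<forall>x. N x = 0 \<longrightarrow> x = 0) \<and>
     (\<forall>c x. N (c *\<^sub>R x) = \<bar>c\<bar> * N x) \<and>
     (\<forall>x y. N (x + y) \<le> N x + N y) \<and>
     (\<exists>a b. 0 < a \<and> 0 < b \<and> (\<forall>x. a * norm x \<le> N x \<and> N x \<le> b * norm x))"

text \<open>
  The modulus of smoothness of a norm is nonnegative, so inserting \<open>0\<close> does not change the
  supremum; it only fixes the value in the trivial space, whose unit sphere is empty.
\<close>
definition modulus_of_smoothness :: "('a::real_vector \<Rightarrow> real) \<Rightarrow> real \<Rightarrow> real" where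
  "modulus_of_smoothness N t =
     Sup (insert 0 {(N (x + t *\<^sub>R h) + N (x - t *\<^sub>R h)) / 2 - 1 | x h. N x = 1 \<and> N h = 1})"

definition uniformly_smooth :: "('a::real_vector \<Rightarrow> real) \<Rightarrow> bool" where
  "uniformly_smooth N \<longleftrightarrow> ((\<lambda>t. modulus_of_smoothness N t / t) \<longlongrightarrow> 0) (at_right 0)"

text \<open>
  Super-reflexivity is taken in its renorming form; that this agrees with James' definition
  by finite representability is a theorem of Enflo.
\<close>
definition super_reflexive :: "'a::banach itself \<Rightarrow> bool" where
  "super_reflexive _ \<longleftrightarrow> (\<exists>N::'a \<Rightarrow> real. equivalent_norm N \<and> uniformly_smooth N)"

text \<open>
  The derivative as an element of the dual space. The value is meaningful only where \<open>F\<close> is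
  differentiable.
\<close>
definition DF :: "('a::real_normed_vector \<Rightarrow> real) \<Rightarrow> 'a \<Rightarrow> ('a \<Rightarrow>\<^sub>L real)" where
  "DF F x = Blinfun (frechet_derivative F (at x))"

text \<open>
  For open \<open>U\<close>. Functions on \<open>U\<close> are represented by total functions whose values outside
  \<open>U\<close> are irrelevant.
\<close>
definition C1plus :: "'a::real_normed_vector set \<Rightarrow> ('a \<Rightarrow> real) set" where
  "C1plus U = {F. (\<forall>x\<in>U. F differentiable (at x)) \<and> uniformly_continuous_on U (DF F)}"

definition condition_W ::
  "'a::real_normed_vector set \<Rightarrow> ('a \<Rightarrow> real) \<Rightarrow> ('a \<Rightarrow> ('a \<Rightarrow>\<^sub>L real)) \<Rightarrow> bool" where
  "condition_W E f G \<longleftrightarrow>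
     uniformly_continuous_on E G \<and>
     (\<forall>\<epsilon>>0. \<exists>\<delta>>0. \<forall>x\<in>E. \<forall>y\<in>E. norm (y - x) < \<delta> \<longrightarrow>
        \<bar>f y - f x - blinfun_apply (G x) (y - x)\<bar> \<le> \<epsilon> * norm (y - x))"

end

theory Submission imports Defs begin

text \<open>
  The substance is the implication (ii) \<open>\<Longrightarrow>\<close> (iii) with prescribed derivative, a Whitney extension
  theorem; everything else follows from the mean value inequality and short direct estimates.

  Call \<open>f y + G y (x - y)\<close>, as a function of \<open>x\<close>, the jet at \<open>y\<close>. Boundedness of \<open>G\<close>, the Lipschitz
  condition on \<open>f\<close> and condition (W) say that two jets differ at \<open>x\<close> by at most
  \<open>r \<omega>(r)\<close>, where \<open>r\<close> is the larger of the distances of \<open>x\<close> to the two base points, and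
  \<open>\<omega>\<close> is a bounded modulus. An equivalent uniformly smooth norm \<open>N\<close> supplies a function \<open>\<psi>\<close> that
  dominates \<open>r \<omega>(r)\<close>, vanishes at \<open>0\<close>, is convex and Lipschitz, and has second differences
  \<open>\<psi> (x + h) + \<psi> (x - h) - 2 \<psi> x\<close> of size \<open>o(\<parallel>h\<parallel>)\<close> uniformly in \<open>x\<close>
  (\<open>smooth_convex_gauge_above_cones\<close>); it is a series of functions of the form
  \<open>N\<^sup>2 / (a + N)\<close>. Hence every jet minus \<open>\<psi>\<close> lies below every jet plus \<open>\<psi>\<close>
  (\<open>gauge_separates_jets\<close>).

  Let \<open>g\<close> be the infimum of all jets plus \<open>\<psi>\<close>. It is semiconcave, with a modulus \<open>c\<close> taken from
  \<open>\<psi>\<close>. The extension \<open>F\<close> is the largest function below \<open>g\<close> that is semiconvex with this modulus.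
  The class of semiconvex functions with a given modulus is stable under translations, convex
  combinations and subtraction of constants. Comparing \<open>F\<close> with averages of its translates therefore
  shows that \<open>F\<close> inherits the semiconcavity of \<open>g\<close> (\<open>defect_envelope_le\<close>), and its Lipschitz constant
  as well. A Lipschitz function that is semiconvex and semiconcave with a uniform modulus has a
  uniformly continuous derivative (\<open>C1plus_if_small_defects\<close>). Finally, each jet minus
  \<open>\<psi>\<close> is itself semiconvex, so near a point \<open>y\<close> of \<open>E\<close> the function \<open>F\<close> is squeezed between the jet
  at \<open>y\<close> minus \<open>\<psi>\<close> and plus \<open>\<psi>\<close>. As \<open>\<psi> v = o(\<parallel>v\<parallel>)\<close>, this gives \<open>F y = f y\<close> and
  \<open>DF F y = G y\<close>.
\<close>

section \<open>Uniformly differentiable functions and their restrictions\<close>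

lemma condition_W_subset:
  assumes "condition_W S F G" "E \<subseteq> S" "\<And>x. x \<in> E \<Longrightarrow> F x = f x"
  shows "condition_W E f G"
  unfolding condition_W_def
proof (intro conjI allI impI)
  show "uniformly_continuous_on E G"
    using assms(1,2) unfolding condition_W_def uniformly_continuous_on_def by (meson subsetD)
  fix \<epsilon> :: real assume "\<epsilon> > 0"
  then obtain \<delta> where "\<delta> > 0"
    and \<delta>: "\<And>x y. x \<in> S \<Longrightarrow> y \<in> S \<Longrightarrow> norm (y - x) < \<delta> \<Longrightarrow> \<bar>F y - F x - G x (y - x)\<bar> \<le> \<epsilon> * norm (y - x)"
    using assms(1) unfolding condition_W_def by blast
  have "\<bar>f y - f x - G x (y - x)\<bar> \<le> \<epsilon> * norm (y - x)"
    if "x \<in> E" "y \<in> E" "norm (y - x) < \<delta>" for x y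
  proof -
    have "x \<in> S" "y \<in> S" using that assms(2) by auto
    from \<delta>[OF this that(3)] show ?thesis using assms(3) that by simp
  qed
  with \<open>\<delta> > 0\<close> show "\<exists>\<delta>>0. \<forall>x\<in>E. \<forall>y\<in>E. norm (y - x) < \<delta> \<longrightarrow> \<bar>f y - f x - G x (y - x)\<bar> \<le> \<epsilon> * norm (y - x)"
    by blast
qed

text \<open>
  At short distances (W) compares \<open>f\<close> with a linear map of norm at most \<open>sup \<parallel>G\<parallel>\<close>; at distances at
  least \<open>\<delta>\<close> the oscillation of \<open>f\<close> is a bounded multiple of the distance.
\<close>

lemma bounded_condition_W_imp_lipschitz:
  assumes f: "bounded (f ` E)" and G: "bounded (G ` E)" and W: "condition_W E f G"
  shows "\<exists>L. L-lipschitz_on E f"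
proof -
  obtain B where B: "B > 0" "\<And>x. x \<in> E \<Longrightarrow> \<bar>f x\<bar> \<le> B" using f by (auto simp: bounded_pos)
  obtain M where M: "M > 0" "\<And>x. x \<in> E \<Longrightarrow> norm (G x) \<le> M" using G by (auto simp: bounded_pos)
  obtain \<delta> where \<delta>: "\<delta> > 0"
    "\<And>x y. x \<in> E \<Longrightarrow> y \<in> E \<Longrightarrow> norm (y - x) < \<delta> \<Longrightarrow> \<bar>f y - f x - G x (y - x)\<bar> \<le> 1 * norm (y - x)"
    using W unfolding condition_W_def by (metis zero_less_one)
  have "(M + 1 + 2 * B / \<delta>)-lipschitz_on E f"
  proof (rule lipschitz_onI)
    fix y x assume xy: "y \<in> E" "x \<in> E"
    let ?n = "norm (y - x)"
    have "\<bar>f y - f x\<bar> \<le> (M + 1) * ?n + 2 * B / \<delta> * ?n"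
    proof (cases "?n < \<delta>")
      case True
      have "\<bar>G x (y - x)\<bar> \<le> M * ?n"
        using order_trans[OF norm_blinfun mult_right_mono[OF M(2)[OF xy(2)]]] by simp
      moreover have "0 \<le> 2 * B / \<delta> * ?n" using B \<delta> by simp
      ultimately show ?thesis using \<delta>(2)[OF xy(2,1) True] by (simp add: distrib_right)
    next
      case False
      have "2 * B * 1 \<le> 2 * B * (?n / \<delta>)" using False B \<delta> by (intro mult_left_mono) auto
      moreover have "0 \<le> (M + 1) * ?n" using M by simp
      ultimately show ?thesis using B(2)[OF xy(1)] B(2)[OF xy(2)] by simp
    qed
    then show "dist (f y) (f x) \<le> (M + 1 + 2 * B / \<delta>) * dist y x"
      by (simp add: dist_norm distrib_right)
  qed (use M B \<delta> in simp)
  then show ?thesis by blast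
qed

lemma C1plus_has_derivative:
  assumes "F \<in> C1plus UNIV"
  shows "(F has_derivative DF F x) (at x)"
proof -
  have "(F has_derivative frechet_derivative F (at x)) (at x)"
    using assms by (simp add: C1plus_def frechet_derivative_works)
  moreover from this have "blinfun_apply (DF F x) = frechet_derivative F (at x)"
    unfolding DF_def by (intro bounded_linear_Blinfun_apply has_derivative_bounded_linear)
  ultimately show ?thesis by simp
qed

text \<open>
  The mean value inequality, applied on a ball in which the derivative varies by at most \<open>\<epsilon>\<close>.
\<close>

lemma C1plus_condition_W:
  fixes F :: "'a::real_normed_vector \<Rightarrow> real"
  assumes F: "F \<in> C1plus UNIV"
  shows "condition_W UNIV F (DF F)"
  unfolding condition_W_def
proof (intro conjI allI impI)
  show uc: "uniformly_continuous_on UNIV (DF F)" using F by (simp add: C1plus_def)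
  fix \<epsilon> :: real assume "\<epsilon> > 0"
  then obtain \<delta> where \<delta>: "\<delta> > 0" "\<And>x y. dist y x < \<delta> \<Longrightarrow> dist (DF F y) (DF F x) < \<epsilon>"
    using uc unfolding uniformly_continuous_on_def by blast
  have "\<bar>F y - F x - DF F x (y - x)\<bar> \<le> \<epsilon> * norm (y - x)" if "norm (y - x) < \<delta>" for x y
  proof -
    have "norm (F y - F x - DF F x (y - x)) \<le> norm (y - x) * \<epsilon>"
    proof (rule differentiable_bound_linearization[where S = "ball x \<delta>"])
      fix t :: real assume "t \<in> {0..1}"
      then have "\<bar>t\<bar> * norm (y - x) \<le> norm (y - x)" by (intro mult_left_le_one_le) auto
      with that show "x + t *\<^sub>R (y - x) \<in> ball x \<delta>" by (simp add: dist_norm)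
    next
      show "(F has_derivative DF F z) (at z within ball x \<delta>)" for z
        using C1plus_has_derivative[OF F] by (rule has_derivative_at_withinI)
    next
      fix z assume "z \<in> ball x \<delta>"
      then have "norm (DF F z - DF F x) \<le> \<epsilon>" using \<delta>(2)[of z x] by (simp add: dist_commute flip: dist_norm)
      then show "onorm (blinfun_apply (DF F z) - blinfun_apply (DF F x)) \<le> \<epsilon>"
        by (simp add: norm_blinfun.rep_eq minus_blinfun.rep_eq fun_diff_def)
    qed (use \<delta> in simp)
    then show ?thesis by (simp add: mult.commute)
  qed
  with \<delta>(1) show "\<exists>\<delta>>0. \<forall>x\<in>UNIV. \<forall>y\<in>UNIV. norm (y - x) < \<delta> \<longrightarrow> \<bar>F y - F x - DF F x (y - x)\<bar> \<le> \<epsilon> * norm (y - x)"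
    by blast
qed

text \<open>
  Short increments are approximated by the derivative with an error of at most their length, so the
  derivative is bounded on short vectors by the Lipschitz constant plus \<open>1\<close>; homogeneity gives the
  bound on all vectors.
\<close>

lemma C1plus_lipschitz_imp_bounded_DF:
  fixes F :: "'a::real_normed_vector \<Rightarrow> real"
  assumes F: "F \<in> C1plus UNIV" and L: "L-lipschitz_on UNIV F"
  shows "bounded (range (DF F))"
proof -
  obtain \<delta> where \<delta>: "\<delta> > 0"
    "\<And>x y. norm (y - x) < \<delta> \<Longrightarrow> \<bar>F y - F x - DF F x (y - x)\<bar> \<le> 1 * norm (y - x)"
    using C1plus_condition_W[OF F] unfolding condition_W_def by (metis UNIV_I zero_less_one)
  have L0: "0 \<le> L" by (rule lipschitz_on_nonneg[OF L])
  have "norm (DF F x) \<le> L + 1" for x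
  proof (rule norm_blinfun_bound)
    fix v
    show "norm (DF F x v) \<le> (L + 1) * norm v"
    proof (cases "v = 0")
      case False
      define s where "s = \<delta> / (2 * norm v)"
      have s: "s > 0" using False \<delta> by (simp add: s_def)
      have "norm (s *\<^sub>R v) < \<delta>" using False \<delta> by (simp add: s_def)
      then have "\<bar>F (x + s *\<^sub>R v) - F x - DF F x (s *\<^sub>R v)\<bar> \<le> 1 * norm (s *\<^sub>R v)"
        using \<delta>(2)[of "x + s *\<^sub>R v" x] by simp
      moreover have "\<bar>F (x + s *\<^sub>R v) - F x\<bar> \<le> L * norm (s *\<^sub>R v)"
        using lipschitz_onD[OF L, of "x + s *\<^sub>R v" x] by (simp add: dist_norm)
      ultimately have "\<bar>DF F x (s *\<^sub>R v)\<bar> \<le> (L + 1) * norm (s *\<^sub>R v)" by (simp add: distrib_right)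
      then have "s * \<bar>DF F x v\<bar> \<le> s * ((L + 1) * norm v)"
        using s by (simp add: blinfun.scaleR_right abs_mult mult.left_commute)
      then show ?thesis using s by simp
    qed simp
  qed (use L0 in simp)
  then show ?thesis by (auto simp: bounded_iff)
qed

text \<open>
  Balls need not be totally bounded in infinite dimension. They are convex, however, so that \<open>0\<close> is
  joined to every point of the ball by a chain of short steps whose number depends on the radius only.
\<close>

lemma uniformly_continuous_bounded_on_cball:
  fixes g :: "'a::real_normed_vector \<Rightarrow> 'b::real_normed_vector"
  assumes "uniformly_continuous_on UNIV g"
  shows "\<exists>B. \<forall>x\<in>cball 0 R. norm (g x) \<le> B"
proof -
  obtain \<delta> where \<delta>: "\<delta> > 0" "\<And>x y. dist y x < \<delta> \<Longrightarrow> dist (g y) (g x) < 1"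
    using assms unfolding uniformly_continuous_on_def by (metis UNIV_I zero_less_one)
  have chain: "norm (g x - g 0) \<le> real n" if "norm x \<le> real n * (\<delta> / 2)" for n x
    using that
  proof (induction n arbitrary: x)
    case (Suc n)
    define y where "y = (real n / real (Suc n)) *\<^sub>R x"
    have "norm x / real (Suc n) \<le> \<delta> / 2"
      using Suc.prems by (simp add: pos_divide_le_eq mult.commute del: of_nat_Suc)
    moreover have "norm y = real n * (norm x / real (Suc n))" by (simp add: y_def)
    ultimately have "norm y \<le> real n * (\<delta> / 2)" by (metis mult_left_mono of_nat_0_le_iff)
    then have 1: "norm (g y - g 0) \<le> real n" by (rule Suc.IH)
    have "x - y = (1 / real (Suc n)) *\<^sub>R x"
    proof -
      have "1 - real n / real (Suc n) = 1 / real (Suc n)" by (simp add: field_simps)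
      then show ?thesis using scaleR_left_diff_distrib[of 1 "real n / real (Suc n)" x]
        by (simp add: y_def del: of_nat_Suc)
    qed
    then have "norm (x - y) \<le> \<delta> / 2" using \<open>norm x / real (Suc n) \<le> \<delta> / 2\<close> by simp
    then have "norm (g x - g y) < 1" using \<delta>(1) \<delta>(2)[of x y] by (simp add: dist_norm)
    with 1 show ?case using norm_triangle_ineq[of "g x - g y" "g y - g 0"] by simp
  qed simp
  obtain n where n: "R / (\<delta> / 2) < real n" using reals_Archimedean2 by blast
  have "norm (g x) \<le> real n + norm (g 0)" if "x \<in> cball 0 R" for x
  proof -
    have "R \<le> real n * (\<delta> / 2)" using n \<delta>(1) by (simp add: pos_divide_less_eq)
    with that have "norm (g x - g 0) \<le> real n" by (intro chain) simp
    then show ?thesis using norm_triangle_ineq[of "g x - g 0" "g 0"] by simp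
  qed
  then show ?thesis by blast
qed

lemma C1plus_on_bounded_set:
  fixes F :: "'a::real_normed_vector \<Rightarrow> real"
  assumes F: "F \<in> C1plus UNIV" and E: "bounded E"
  shows "bounded (DF F ` E)" "\<exists>L. L-lipschitz_on E F"
proof -
  obtain R where R: "E \<subseteq> cball 0 R" using E by (auto simp: bounded_iff subset_iff)
  have "uniformly_continuous_on UNIV (DF F)" using F by (simp add: C1plus_def)
  from uniformly_continuous_bounded_on_cball[OF this, of R]
  obtain B where B: "\<And>x. x \<in> cball 0 R \<Longrightarrow> norm (DF F x) \<le> B" by blast
  show "bounded (DF F ` E)" unfolding bounded_iff using B R by blast
  have "\<bar>B\<bar>-lipschitz_on (cball 0 R) F"
  proof (rule lipschitz_onI)
    fix x y :: 'a assume xy: "x \<in> cball 0 R" "y \<in> cball 0 R"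
    have "norm (F x - F y) \<le> \<bar>B\<bar> * norm (x - y)"
    proof (rule differentiable_bound[OF convex_cball _ _ xy])
      show "(F has_derivative DF F z) (at z within cball 0 R)" for z
        using C1plus_has_derivative[OF F] by (rule has_derivative_at_withinI)
      show "onorm (blinfun_apply (DF F z)) \<le> \<bar>B\<bar>" if "z \<in> cball 0 R" for z
        using B[OF that] by (simp flip: norm_blinfun.rep_eq)
    qed
    then show "dist (F x) (F y) \<le> \<bar>B\<bar> * dist x y" by (simp add: dist_norm)
  qed simp
  then show "\<exists>L. L-lipschitz_on E F" using R lipschitz_on_subset by blast
qed

section \<open>A smooth convex gauge built from a uniformly smooth norm\<close>

lemma equivalent_norm_nonneg:
  assumes "equivalent_norm N"
  shows "0 \<le> N x"
proof -
  from assms obtain a where "0 < a" "a * norm x \<le> N x" by (auto simp: equivalent_norm_def)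
  then show ?thesis by (smt (verit) mult_nonneg_nonneg norm_ge_zero)
qed

text \<open>
  The homogeneous form of uniform smoothness: with \<open>t = N h / N x\<close>, the vectors \<open>x / N x\<close> and
  \<open>h / N h\<close> enter the modulus of smoothness at \<open>t\<close>.
\<close>

lemma uniformly_smooth_second_difference:
  fixes N :: "'a::real_normed_vector \<Rightarrow> real"
  assumes N: "equivalent_norm N" and smooth: "uniformly_smooth N" and "\<epsilon> > 0"
  obtains \<delta> where "\<delta> > 0" "\<And>x h. N h \<le> \<delta> * N x \<Longrightarrow> N (x + h) + N (x - h) - 2 * N x \<le> \<epsilon> * N h"
proof -
  have N_pos: "N x = 0 \<Longrightarrow> x = 0" and N_scale: "N (c *\<^sub>R x) = \<bar>c\<bar> * N x"
    and N_tri: "N (x + y) \<le> N x + N y" for c x y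
    using N by (auto simp: equivalent_norm_def)
  note N_nonneg = equivalent_norm_nonneg[OF N]
  have "\<forall>\<^sub>F t in at_right 0. modulus_of_smoothness N t / t < \<epsilon> / 2"
    using smooth \<open>\<epsilon> > 0\<close> unfolding uniformly_smooth_def by (intro order_tendstoD) auto
  then obtain b where b: "b > 0" "\<And>t. 0 < t \<Longrightarrow> t < b \<Longrightarrow> modulus_of_smoothness N t / t < \<epsilon> / 2"
    by (auto simp: eventually_at_right_field)
  show ?thesis
  proof (rule that[of "b / 2"])
    fix x h assume hx: "N h \<le> b / 2 * N x"
    show "N (x + h) + N (x - h) - 2 * N x \<le> \<epsilon> * N h"
    proof (cases "h = 0")
      case True
      then show ?thesis using N_scale[of 0 h] by simp
    next
      case False
      then have h: "N h > 0" using N_pos N_nonneg by (metis less_eq_real_def)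
      then have x: "N x > 0" using hx b(1) by (smt (verit) zero_less_mult_iff half_gt_zero)
      define t where "t = N h / N x"
      define u where "u = x /\<^sub>R N x"
      define v where "v = h /\<^sub>R N h"
      have uv: "N u = 1" "N v = 1" using h x by (simp_all add: u_def v_def N_scale)
      have tb: "0 < t" "t < b"
      proof -
        show "0 < t" using h x by (simp add: t_def)
        have "t \<le> b / 2" using hx x by (simp add: t_def pos_divide_le_eq)
        then show "t < b" using b(1) by simp
      qed
      let ?S = "{(N (y + t *\<^sub>R k) + N (y - t *\<^sub>R k)) / 2 - 1 | y k. N y = 1 \<and> N k = 1}"
      \<comment> \<open>The supremum bounds its elements only once it is known to be finite.\<close>
      have "bdd_above (insert 0 ?S)"
      proof (rule bdd_aboveI[of _ t])
        fix z assume "z \<in> insert 0 ?S"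
        moreover have "(N (y + t *\<^sub>R k) + N (y - t *\<^sub>R k)) / 2 - 1 \<le> t" if "N y = 1" "N k = 1" for y k
          using N_tri[of y "t *\<^sub>R k"] N_tri[of y "(- t) *\<^sub>R k"] that tb N_scale[of t k] N_scale[of "- t" k]
          by (simp add: field_simps)
        ultimately show "z \<le> t" using tb by auto
      qed
      then have "(N (u + t *\<^sub>R v) + N (u - t *\<^sub>R v)) / 2 - 1 \<le> modulus_of_smoothness N t"
        unfolding modulus_of_smoothness_def using uv by (intro cSup_upper) blast+
      also have "\<dots> \<le> \<epsilon> / 2 * t" using b(2)[OF tb] tb by (simp add: pos_divide_less_eq)
      finally have 1: "N (u + t *\<^sub>R v) + N (u - t *\<^sub>R v) - 2 \<le> \<epsilon> * t" by (simp add: field_simps)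
      have "t *\<^sub>R v = h /\<^sub>R N x" using h by (simp add: t_def v_def divide_inverse)
      then have "u + t *\<^sub>R v = (x + h) /\<^sub>R N x" "u - t *\<^sub>R v = (x - h) /\<^sub>R N x"
        by (simp_all add: u_def scaleR_add_right scaleR_diff_right)
      then have "N (u + t *\<^sub>R v) = N (x + h) / N x" "N (u - t *\<^sub>R v) = N (x - h) / N x"
        using x by (simp_all only: N_scale abs_inverse abs_of_pos divide_inverse mult.commute)
      with 1 have "N (x + h) / N x + N (x - h) / N x - 2 \<le> \<epsilon> * t" by simp
      then have "N x * (N (x + h) / N x + N (x - h) / N x - 2) \<le> N x * (\<epsilon> * t)"
        using x by (intro mult_left_mono) auto
      moreover have "N x * (N (x + h) / N x + N (x - h) / N x - 2) = N (x + h) + N (x - h) - 2 * N x"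
        using x by (simp add: right_diff_distrib distrib_left)
      moreover have "N x * (\<epsilon> * t) = \<epsilon> * N h" using x by (simp add: t_def)
      ultimately show ?thesis by simp
    qed
  qed (use b in simp)
qed

text \<open>
  The function of one real variable that is composed with the norm. It behaves like
  \<open>s\<^sup>2 / a\<close> for small \<open>s\<close>, which removes the singularity of the norm at the origin, and like \<open>s\<close> for
  large \<open>s\<close>, which keeps it Lipschitz. The parameter \<open>a\<close> is the scale at which the behaviour changes.
\<close>

definition profile :: "real \<Rightarrow> real \<Rightarrow> real" where
  "profile a s = s\<^sup>2 / (a + s)"

context
  fixes a s u :: real
  assumes pos: "0 < a" "0 \<le> s" "0 \<le> u"
begin

lemma profile_nonneg: "0 \<le> profile a s"
  using pos by (simp add: profile_def)

lemma profile_le: "profile a s \<le> s"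
  using pos by (simp add: profile_def divide_le_eq power2_eq_square algebra_simps)

lemma profile_ge_half: "a \<le> s \<Longrightarrow> s / 2 \<le> profile a s"
proof -
  assume "a \<le> s"
  then have "s * a \<le> s * s" using pos by (intro mult_left_mono) auto
  then show ?thesis using pos by (simp add: profile_def le_divide_eq power2_eq_square algebra_simps)
qed

lemma profile_diff: "profile a u - profile a s = (u - s) * ((u * s + a * (u + s)) / ((a + u) * (a + s)))"
proof -
  have "a + u \<noteq> 0" "a + s \<noteq> 0" using pos by auto
  then show ?thesis by (simp add: profile_def divide_simps) (simp add: power2_eq_square algebra_simps)
qed

lemma profile_lipschitz: "\<bar>profile a u - profile a s\<bar> \<le> \<bar>u - s\<bar>"
proof -
  have "(u * s + a * (u + s)) / ((a + u) * (a + s)) \<le> 1"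
    using pos by (subst divide_le_eq_1_pos) (simp_all add: algebra_simps add_pos_nonneg)
  moreover have "0 \<le> (u * s + a * (u + s)) / ((a + u) * (a + s))" using pos by simp
  ultimately show ?thesis
    unfolding profile_diff abs_mult by (intro mult_left_le) (simp_all only: abs_of_nonneg abs_ge_zero)
qed

text \<open>
  Near the origin the slope is of order \<open>s / a\<close>; this replaces the smoothness of the norm there.
\<close>

lemma profile_flat: "\<bar>profile a u - profile a s\<bar> \<le> \<bar>u - s\<bar> * ((u + s) / a)"
proof -
  have "(u * s + a * (u + s)) * a \<le> (u + s) * ((a + u) * (a + s))"
  proof -
    have "(u + s) * ((a + u) * (a + s)) - (u * s + a * (u + s)) * a
        = a * (u * u + u * s + s * s) + (u + s) * (u * s)"
      by (simp add: algebra_simps)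
    moreover have "0 \<le> a * (u * u + u * s + s * s) + (u + s) * (u * s)"
      using pos by simp
    ultimately show ?thesis by linarith
  qed
  then have "(u * s + a * (u + s)) / ((a + u) * (a + s)) \<le> (u + s) / a"
    using pos by (simp add: frac_le_eq divide_le_eq le_divide_eq add_pos_nonneg)
  moreover have "0 \<le> (u * s + a * (u + s)) / ((a + u) * (a + s))" using pos by simp
  ultimately show ?thesis
    unfolding profile_diff abs_mult by (intro mult_left_mono) (simp_all only: abs_of_nonneg abs_ge_zero)
qed

lemma profile_mono: "s \<le> u \<Longrightarrow> profile a s \<le> profile a u"
proof -
  assume "s \<le> u"
  then have "0 \<le> profile a u - profile a s" unfolding profile_diff using pos by simp
  then show ?thesis by simp
qed

text \<open>
  First order expansion with exact remainder. The remainder is nonnegative, which gives convexity, and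
  at most \<open>(u - s)\<^sup>2 / a\<close>, which gives smoothness; the slope lies between \<open>0\<close> and \<open>1\<close>.
\<close>

lemma profile_Taylor:
  shows "profile a u - profile a s = (1 - (a / (a + s))\<^sup>2) * (u - s) + (a / (a + s))\<^sup>2 * ((u - s)\<^sup>2 / (a + u))"
proof -
  have "a + u \<noteq> 0" "a + s \<noteq> 0" using pos by auto
  then show ?thesis
    by (simp add: profile_def power_divide divide_simps) (simp add: power2_eq_square algebra_simps)
qed

lemma profile_upper_Taylor: "profile a u - profile a s \<le> (1 - (a / (a + s))\<^sup>2) * (u - s) + (u - s)\<^sup>2 / a"
proof -
  have "(a / (a + s))\<^sup>2 \<le> 1" using pos by (intro power_le_one) auto
  then have "(a / (a + s))\<^sup>2 * ((u - s)\<^sup>2 / (a + u)) \<le> 1 * ((u - s)\<^sup>2 / a)"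
    using pos by (intro mult_mono frac_le) auto
  then show ?thesis unfolding profile_Taylor by simp
qed

lemma profile_tangent_le: "profile a s + (1 - (a / (a + s))\<^sup>2) * (u - s) \<le> profile a u"
proof -
  have "0 \<le> (a / (a + s))\<^sup>2 * ((u - s)\<^sup>2 / (a + u))" using pos by simp
  with profile_Taylor show ?thesis by linarith
qed

end

lemma profile_convex:
  assumes "0 < a" "0 \<le> u" "0 \<le> w" "0 \<le> t" "t \<le> 1"
  shows "profile a (t * u + (1 - t) * w) \<le> t * profile a u + (1 - t) * profile a w"
proof -
  define s where "s = t * u + (1 - t) * w"
  define p where "p = 1 - (a / (a + s))\<^sup>2"
  have s: "0 \<le> s" using assms by (simp add: s_def)
  have "t * (profile a s + p * (u - s)) + (1 - t) * (profile a s + p * (w - s))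
      \<le> t * profile a u + (1 - t) * profile a w"
    unfolding p_def using assms s by (intro add_mono mult_left_mono profile_tangent_le) auto
  moreover have "t * (profile a s + p * (u - s)) + (1 - t) * (profile a s + p * (w - s))
      = profile a s + p * (t * u + (1 - t) * w - s)"
    by (simp add: algebra_simps)
  ultimately show ?thesis by (simp add: s_def)
qed

text \<open>
  Where \<open>N x < \<rho>\<close>, the profile is so flat that each of the two differences is small by itself. Where
  \<open>N x \<ge> \<rho>\<close>, the first order parts add up to a second difference of \<open>N\<close>, small by uniform smoothness,
  and the remainders are quadratic in \<open>N h\<close>.
\<close>

lemma profile_norm_second_difference:
  fixes N :: "'a::real_normed_vector \<Rightarrow> real"
  assumes N: "equivalent_norm N" and smooth: "uniformly_smooth N" and "\<epsilon> > 0" "a > 0"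
  shows "\<exists>\<delta>>0. \<forall>x h. N h < \<delta> \<longrightarrow>
    profile a (N (x + h)) + profile a (N (x - h)) - 2 * profile a (N x) \<le> \<epsilon> * N h"
proof -
  have N_scale: "N (c *\<^sub>R x) = \<bar>c\<bar> * N x"
    and N_tri: "N (x + y) \<le> N x + N y" for c x y
    using N by (auto simp: equivalent_norm_def)
  note N_nonneg = equivalent_norm_nonneg[OF N]
  have N_minus: "N (- x) = N x" for x using N_scale[of "-1" x] by simp
  have N_diff: "\<bar>N (x + h) - N x\<bar> \<le> N h" "\<bar>N (x - h) - N x\<bar> \<le> N h" for x h
    using N_tri[of x h] N_tri[of "x + h" "- h"] N_tri[of x "- h"] N_tri[of "x - h" h] N_minus[of h]
    by auto
  obtain \<delta> where \<delta>: "\<delta> > 0"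
    "\<And>x h. N h \<le> \<delta> * N x \<Longrightarrow> N (x + h) + N (x - h) - 2 * N x \<le> \<epsilon> / 2 * N h"
    using uniformly_smooth_second_difference[OF N smooth, of "\<epsilon> / 2"] \<open>\<epsilon> > 0\<close> by auto
  define \<rho> where "\<rho> = \<epsilon> * a / 6"
  have \<rho>: "\<rho> > 0" using assms by (simp add: \<rho>_def)
  show ?thesis
  proof (intro exI[of _ "Min {\<rho>, \<delta> * \<rho>, \<epsilon> * a / 4}"] conjI allI impI)
    show "0 < Min {\<rho>, \<delta> * \<rho>, \<epsilon> * a / 4}" using \<rho> \<delta>(1) assms by simp
    fix x h assume "N h < Min {\<rho>, \<delta> * \<rho>, \<epsilon> * a / 4}"
    then have h: "N h < \<rho>" "N h < \<delta> * \<rho>" "N h < \<epsilon> * a / 4" by auto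
    let ?u = "N (x + h)" and ?w = "N (x - h)" and ?s = "N x"
    show "profile a ?u + profile a ?w - 2 * profile a ?s \<le> \<epsilon> * N h"
    proof (cases "?s < \<rho>")
      case True
      have *: "profile a v - profile a ?s \<le> N h * (\<epsilon> / 2)" if "\<bar>v - ?s\<bar> \<le> N h" "0 \<le> v" for v
      proof -
        have "profile a v - profile a ?s \<le> \<bar>v - ?s\<bar> * ((v + ?s) / a)"
          using profile_flat[OF \<open>a > 0\<close> N_nonneg that(2), of x] by linarith
        also have "\<dots> \<le> N h * (3 * \<rho> / a)"
          using that True h N_nonneg assms by (intro mult_mono divide_right_mono divide_nonneg_pos) auto
        also have "3 * \<rho> / a = \<epsilon> / 2" using \<open>a > 0\<close> by (simp add: \<rho>_def)
        finally show ?thesis .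
      qed
      from *[OF N_diff(1) N_nonneg] *[OF N_diff(2) N_nonneg] show ?thesis
        by (simp add: algebra_simps)
    next
      case False
      then have "\<delta> * \<rho> \<le> \<delta> * ?s" using \<delta>(1) by simp
      then have d: "?u + ?w - 2 * ?s \<le> \<epsilon> / 2 * N h" using \<delta>(2)[of h x] h by simp
      define p where "p = 1 - (a / (a + ?s))\<^sup>2"
      have p: "0 \<le> p" "p \<le> 1"
        using \<open>a > 0\<close> N_nonneg[of x] by (auto simp: p_def intro!: power_le_one)
      have *: "profile a v - profile a ?s \<le> p * (v - ?s) + N h * (\<epsilon> / 4)" if "\<bar>v - ?s\<bar> \<le> N h" "0 \<le> v" for v
      proof -
        have "(v - ?s)\<^sup>2 = \<bar>v - ?s\<bar> * \<bar>v - ?s\<bar>" by (simp add: power2_eq_square)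
        also have "\<dots> \<le> N h * N h" using that N_nonneg by (intro mult_mono) auto
        also have "\<dots> \<le> N h * (\<epsilon> * a / 4)" using h N_nonneg by (intro mult_left_mono) auto
        finally have "(v - ?s)\<^sup>2 / a \<le> N h * (\<epsilon> / 4)" using \<open>a > 0\<close> by (simp add: field_simps)
        with profile_upper_Taylor[OF \<open>a > 0\<close> N_nonneg that(2), of x] show ?thesis
          unfolding p_def by linarith
      qed
      have "p * (?u + ?w - 2 * ?s) \<le> p * (\<epsilon> / 2 * N h)" using d p by (intro mult_left_mono)
      also have "\<dots> \<le> 1 * (\<epsilon> / 2 * N h)" using p N_nonneg \<open>\<epsilon> > 0\<close> by (intro mult_right_mono) auto
      finally show ?thesis
        using *[OF N_diff(1) N_nonneg] *[OF N_diff(2) N_nonneg] by (simp add: algebra_simps)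
    qed
  qed
qed

text \<open>
  The second difference bound is uniform smoothness of \<open>\<psi>\<close> on the whole space; at \<open>x = 0\<close> it gives
  \<open>\<psi> h = o(\<parallel>h\<parallel>)\<close>.
\<close>

definition smooth_convex_gauge :: "('a::real_normed_vector \<Rightarrow> real) \<Rightarrow> real \<Rightarrow> bool" where
  "smooth_convex_gauge \<psi> K \<longleftrightarrow>
     \<psi> 0 = 0 \<and> (\<forall>x. 0 \<le> \<psi> x) \<and> K-lipschitz_on UNIV \<psi> \<and> convex_on UNIV \<psi> \<and>
     (\<forall>\<epsilon>>0. \<exists>\<delta>>0. \<forall>x h. norm h < \<delta> \<longrightarrow> \<psi> (x + h) + \<psi> (x - h) - 2 * \<psi> x \<le> \<epsilon> * norm h)"

text \<open>
  A bounded modulus is dominated by the step function with value \<open>M / 2\<^sup>k\<close> on \<open>[r k, r (k - 1))\<close> for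
  suitable radii \<open>r k\<close>, so the gauge has to exceed the cone of slope \<open>M / 2\<^sup>k\<close> outside the ball of
  radius \<open>r k\<close>. The \<open>k\<close>-th term of a series with weights \<open>1 / 2\<^sup>k\<close> does this, up to a constant factor,
  if its profile has the scale \<open>a * r k\<close>. All terms have the same Lipschitz constant apart from their
  weights. This makes the tail of the series harmless, and only finitely many terms have to be smooth.
\<close>

lemma smooth_convex_gauge_above_cones:
  fixes r :: "nat \<Rightarrow> real"
  assumes "super_reflexive TYPE('a::banach)" and "0 < M" and r: "\<And>k. 0 < r k"
  obtains \<psi> :: "'a::banach \<Rightarrow> real" and L where
    "smooth_convex_gauge \<psi> L"
    "\<And>k v. r k \<le> norm v \<Longrightarrow> M * (1/2)^k * norm v \<le> \<psi> v"
proof -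
  obtain N :: "'a \<Rightarrow> real" where N: "equivalent_norm N" and smooth: "uniformly_smooth N"
    using assms(1) by (auto simp: super_reflexive_def)
  obtain a b where ab: "0 < a" "0 < b" "\<And>x. a * norm x \<le> N x" "\<And>x. N x \<le> b * norm x"
    using N by (auto simp: equivalent_norm_def)
  have N_scale: "N (c *\<^sub>R x) = \<bar>c\<bar> * N x" and N_tri: "N (x + y) \<le> N x + N y" for c x y
    using N by (auto simp: equivalent_norm_def)
  note N_nonneg = equivalent_norm_nonneg[OF N]
  have N_0: "N 0 = 0" using N_scale[of 0 0] by simp
  have N_diff: "\<bar>N x - N y\<bar> \<le> N (x - y)" for x y
    using N_tri[of "x - y" y] N_tri[of "y - x" x] N_scale[of "-1" "x - y"] by auto
  define \<alpha> where "\<alpha> k = a * r k" for k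
  have \<alpha>: "0 < \<alpha> k" for k using ab r by (simp add: \<alpha>_def)
  define \<phi> where "\<phi> k x = (1/2)^k * profile (\<alpha> k) (N x)" for k x
  have \<phi>_nonneg: "0 \<le> \<phi> k x" for k x
    using profile_nonneg[OF \<alpha> N_nonneg N_nonneg] by (simp add: \<phi>_def)
  have geo: "summable (\<lambda>k. (1/2)^k * c :: real)" "(\<Sum>k. (1/2)^k * c) = 2 * c" for c :: real
    using summable_mult2[OF summable_geometric, of "1/2 :: real" c] suminf_mult2[OF summable_geometric, of "1/2 :: real" c]
      suminf_geometric[of "1/2 :: real"] by auto
  have \<phi>_summable: "summable (\<lambda>k. \<phi> k x)" for x
  proof (rule summable_comparison_test'[OF geo(1)])
    show "norm (\<phi> k x) \<le> (1/2)^k * N x" for k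
      using profile_le[OF \<alpha> N_nonneg N_nonneg] \<phi>_nonneg[of k x] by (auto simp: \<phi>_def)
  qed
  have \<phi>_lip: "\<bar>\<phi> k x - \<phi> k y\<bar> \<le> (1/2)^k * N (x - y)" for k x y
  proof -
    have "\<bar>\<phi> k x - \<phi> k y\<bar> = (1/2)^k * \<bar>profile (\<alpha> k) (N x) - profile (\<alpha> k) (N y)\<bar>"
      unfolding \<phi>_def by (simp add: abs_mult flip: right_diff_distrib)
    also have "\<dots> \<le> (1/2)^k * N (x - y)"
      using order_trans[OF profile_lipschitz[OF \<alpha> N_nonneg N_nonneg] N_diff] by (intro mult_left_mono) auto
    finally show ?thesis .
  qed
  define \<psi> where "\<psi> x = (\<Sum>k. \<phi> k x)" for x
  have \<psi>_lip: "\<bar>\<psi> x - \<psi> y\<bar> \<le> 2 * N (x - y)" for x y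
  proof -
    have "\<bar>\<psi> x - \<psi> y\<bar> = \<bar>\<Sum>k. \<phi> k x - \<phi> k y\<bar>"
      unfolding \<psi>_def using \<phi>_summable by (simp add: suminf_diff)
    also have "\<dots> \<le> (\<Sum>k. (1/2)^k * N (x - y))"
      using norm_suminf_le[OF _ geo(1), of "\<lambda>k. \<phi> k x - \<phi> k y"] \<phi>_lip by simp
    finally show ?thesis unfolding geo .
  qed
  have \<psi>_convex: "\<psi> (t *\<^sub>R x + (1 - t) *\<^sub>R y) \<le> t * \<psi> x + (1 - t) * \<psi> y" if t: "0 \<le> t" "t \<le> 1" for t x y
  proof -
    let ?z = "t *\<^sub>R x + (1 - t) *\<^sub>R y"
    have "\<phi> k ?z \<le> t * \<phi> k x + (1 - t) * \<phi> k y" for k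
    proof -
      have "N ?z \<le> t * N x + (1 - t) * N y"
        using N_tri[of "t *\<^sub>R x" "(1 - t) *\<^sub>R y"] t by (simp add: N_scale)
      then have "profile (\<alpha> k) (N ?z) \<le> profile (\<alpha> k) (t * N x + (1 - t) * N y)"
        using t N_nonneg \<alpha> by (intro profile_mono) auto
      also have "\<dots> \<le> t * profile (\<alpha> k) (N x) + (1 - t) * profile (\<alpha> k) (N y)"
        using t N_nonneg \<alpha> by (intro profile_convex) auto
      finally have "(1/2)^k * profile (\<alpha> k) (N ?z) \<le> (1/2)^k * (t * profile (\<alpha> k) (N x) + (1 - t) * profile (\<alpha> k) (N y))"
        by (intro mult_left_mono) auto
      then show ?thesis by (simp add: \<phi>_def algebra_simps)
    qed
    then have "\<psi> ?z \<le> (\<Sum>k. t * \<phi> k x + (1 - t) * \<phi> k y)"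
      unfolding \<psi>_def using \<phi>_summable by (intro suminf_le summable_add summable_mult) auto
    also have "\<dots> = t * \<psi> x + (1 - t) * \<psi> y"
      unfolding \<psi>_def using \<phi>_summable
      by (simp add: suminf_mult summable_mult flip: suminf_add)
    finally show ?thesis .
  qed
  have \<psi>_smooth: "\<exists>\<delta>>0. \<forall>x h. N h < \<delta> \<longrightarrow> \<psi> (x + h) + \<psi> (x - h) - 2 * \<psi> x \<le> \<epsilon> * N h"
    if "\<epsilon> > 0" for \<epsilon>
  proof -
    have "\<exists>\<delta>>0. \<forall>x h. N h < \<delta> \<longrightarrow> profile (\<alpha> k) (N (x + h)) + profile (\<alpha> k) (N (x - h)) - 2 * profile (\<alpha> k) (N x) \<le> \<epsilon> / 4 * N h" for k
      using that by (intro profile_norm_second_difference[OF N smooth] \<alpha>) auto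
    then obtain d where d: "\<And>k. d k > 0" "\<And>k x h. N h < d k \<Longrightarrow>
        profile (\<alpha> k) (N (x + h)) + profile (\<alpha> k) (N (x - h)) - 2 * profile (\<alpha> k) (N x) \<le> \<epsilon> / 4 * N h"
      by metis
    obtain n where n: "(1/2)^n < \<epsilon> / 8"
      using real_arch_pow_inv[of "\<epsilon> / 8" "1/2"] \<open>\<epsilon> > 0\<close> by auto
    define \<delta> where "\<delta> = Min (insert 1 (d ` {..<n}))"
    have \<delta>: "\<delta> > 0" "\<And>k. k < n \<Longrightarrow> \<delta> \<le> d k" using d(1) by (auto simp: \<delta>_def)
    show ?thesis
    proof (intro exI[of _ \<delta>] conjI allI impI \<delta>(1))
      fix x h assume h: "N h < \<delta>"
      define D where "D k = \<phi> k (x + h) + \<phi> k (x - h) - 2 * \<phi> k x" for k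
      have D_summable: "summable D"
        unfolding D_def by (intro summable_diff summable_add summable_mult \<phi>_summable)
      have D_head: "D k \<le> (1/2)^k * (\<epsilon> / 4 * N h)" if "k < n" for k
      proof -
        have "N h < d k" using h \<delta>(2)[OF that] by simp
        then have "(1/2)^k * (profile (\<alpha> k) (N (x + h)) + profile (\<alpha> k) (N (x - h)) - 2 * profile (\<alpha> k) (N x)) \<le> (1/2)^k * (\<epsilon> / 4 * N h)"
          by (intro mult_left_mono d(2)) auto
        then show ?thesis by (simp add: D_def \<phi>_def algebra_simps)
      qed
      have D_all: "D k \<le> (1/2)^k * (2 * N h)" for k
        using \<phi>_lip[of k "x + h" x] \<phi>_lip[of k "x - h" x] N_scale[of "-1" h] by (simp add: D_def)
      have "\<psi> (x + h) + \<psi> (x - h) - 2 * \<psi> x = suminf D"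
        unfolding \<psi>_def D_def using \<phi>_summable
        by (simp add: suminf_mult summable_mult summable_add flip: suminf_add suminf_diff)
      also have "\<dots> = (\<Sum>k. D (k + n)) + sum D {..<n}"
        by (rule suminf_split_initial_segment[OF D_summable])
      also have "(\<Sum>k. D (k + n)) \<le> (\<Sum>k. (1/2)^k * ((1/2)^n * (2 * N h)))"
      proof (intro suminf_le geo summable_ignore_initial_segment D_summable)
        show "D (k + n) \<le> (1/2)^k * ((1/2)^n * (2 * N h))" for k
          using D_all[of "k + n"] by (simp only: power_add mult.assoc)
      qed
      also have "\<dots> = 4 * (1/2)^n * N h" unfolding geo by simp
      also have "\<dots> \<le> \<epsilon> / 2 * N h" using n N_nonneg by (intro mult_right_mono) auto
      also have "sum D {..<n} \<le> (\<Sum>k<n. (1/2)^k * (\<epsilon> / 4 * N h))"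
        using D_head by (intro sum_mono) auto
      also have "\<dots> \<le> (\<Sum>k. (1/2)^k * (\<epsilon> / 4 * N h))"
        using N_nonneg \<open>\<epsilon> > 0\<close> by (intro sum_le_suminf geo) auto
      also have "\<dots> = \<epsilon> / 2 * N h" unfolding geo by simp
      finally show "\<psi> (x + h) + \<psi> (x - h) - 2 * \<psi> x \<le> \<epsilon> * N h" by simp
    qed
  qed
  \<comment> \<open>The factor 2 undoes the loss in profile_ge_half, and a that of passing between the norms.\<close>
  define C where "C = 2 * M / a"
  have C: "C > 0" using \<open>0 < M\<close> ab by (simp add: C_def)
  show ?thesis
  proof (rule that[of "\<lambda>x. C * \<psi> x" "C * (2 * b)"])
    show "smooth_convex_gauge (\<lambda>x. C * \<psi> x) (C * (2 * b))"
      unfolding smooth_convex_gauge_def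
    proof (intro conjI allI impI)
      show "C * \<psi> 0 = 0" by (simp add: \<psi>_def \<phi>_def N_0 profile_def)
      show "0 \<le> C * \<psi> x" for x
        unfolding \<psi>_def using C \<phi>_nonneg \<phi>_summable by (intro mult_nonneg_nonneg suminf_nonneg) auto
      show "(C * (2 * b))-lipschitz_on UNIV (\<lambda>x. C * \<psi> x)"
      proof (rule lipschitz_onI)
        fix x y
        have "C * \<bar>\<psi> x - \<psi> y\<bar> \<le> C * (2 * (b * norm (x - y)))"
          using \<psi>_lip[of x y] ab(4)[of "x - y"] C by (intro mult_left_mono) auto
        then show "dist (C * \<psi> x) (C * \<psi> y) \<le> C * (2 * b) * dist x y"
          using C by (simp add: dist_norm abs_mult mult.assoc flip: right_diff_distrib)
      qed (use C ab in simp)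
      show "convex_on UNIV (\<lambda>x. C * \<psi> x)"
      proof (rule convex_onI)
        fix t :: real and x y assume t: "0 < t" "t < 1"
        have "C * \<psi> ((1 - t) *\<^sub>R x + t *\<^sub>R y) \<le> C * ((1 - t) * \<psi> x + t * \<psi> y)"
          using \<psi>_convex[of "1 - t" x y] t C by (intro mult_left_mono) auto
        then show "C * \<psi> ((1 - t) *\<^sub>R x + t *\<^sub>R y) \<le> (1 - t) * (C * \<psi> x) + t * (C * \<psi> y)"
          by (simp add: algebra_simps)
      qed simp
      show "\<exists>\<delta>>0. \<forall>x h. norm h < \<delta> \<longrightarrow> C * \<psi> (x + h) + C * \<psi> (x - h) - 2 * (C * \<psi> x) \<le> \<epsilon> * norm h"
        if "\<epsilon> > 0" for \<epsilon>
      proof -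
        have "\<epsilon> / (C * b) > 0" using that C ab by simp
        from \<psi>_smooth[OF this] obtain \<delta> where \<delta>: "\<delta> > 0"
          "\<And>x h. N h < \<delta> \<Longrightarrow> \<psi> (x + h) + \<psi> (x - h) - 2 * \<psi> x \<le> \<epsilon> / (C * b) * N h" by blast
        show ?thesis
        proof (intro exI[of _ "\<delta> / b"] conjI allI impI)
          fix x h :: 'a assume "norm h < \<delta> / b"
          then have "N h < \<delta>" using ab(2) ab(4)[of h] by (simp add: field_simps)
          then have "\<psi> (x + h) + \<psi> (x - h) - 2 * \<psi> x \<le> \<epsilon> / (C * b) * N h" by (rule \<delta>)
          also have "\<dots> \<le> \<epsilon> / (C * b) * (b * norm h)"
            using ab that C by (intro mult_left_mono) auto
          finally have "C * (\<psi> (x + h) + \<psi> (x - h) - 2 * \<psi> x) \<le> C * (\<epsilon> / (C * b) * (b * norm h))"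
            using C by (intro mult_left_mono) auto
          then show "C * \<psi> (x + h) + C * \<psi> (x - h) - 2 * (C * \<psi> x) \<le> \<epsilon> * norm h"
            using C ab by (simp add: algebra_simps)
        qed (use \<delta> ab in simp)
      qed
    qed
    show "M * (1/2)^k * norm v \<le> C * \<psi> v" if "r k \<le> norm v" for k v
    proof -
      have "\<alpha> k \<le> N v"
        unfolding \<alpha>_def using mult_left_mono[OF that, of a] ab(1) ab(3)[of v] by linarith
      have "a * norm v / 2 \<le> N v / 2" using ab(3)[of v] by simp
      also have "\<dots> \<le> profile (\<alpha> k) (N v)"
        by (rule profile_ge_half[OF \<alpha> N_nonneg N_nonneg \<open>\<alpha> k \<le> N v\<close>])
      finally have "(1/2)^k * (a * norm v / 2) \<le> \<phi> k v" unfolding \<phi>_def by (intro mult_left_mono) auto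
      also have "\<dots> = (\<Sum>j\<in>{k}. \<phi> j v)" by simp
      also have "\<dots> \<le> \<psi> v"
        unfolding \<psi>_def using \<phi>_nonneg \<phi>_summable by (intro sum_le_suminf) auto
      finally have "C * ((1/2)^k * (a * norm v / 2)) \<le> C * \<psi> v" using C by (intro mult_left_mono) auto
      then show ?thesis using ab by (simp add: C_def field_simps)
    qed
  qed
qed

section \<open>Semiconvex functions and the semiconvex envelope\<close>

text \<open>
  The points \<open>x + (1 - t) d\<close> and \<open>x - t d\<close> are the ends of a segment with direction \<open>d\<close> that \<open>x\<close> divides
  in the ratio given by \<open>t\<close>. The defect measures by how much the chord exceeds \<open>\<phi>\<close> at \<open>x\<close>; it is
  nonnegative for convex functions and vanishes for affine ones. With the segment described by \<open>t\<close>,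
  \<open>d\<close> and \<open>x\<close>, translations act on \<open>x\<close> alone.
\<close>

definition defect :: "('a::real_vector \<Rightarrow> real) \<Rightarrow> real \<Rightarrow> 'a \<Rightarrow> 'a \<Rightarrow> real" where
  "defect \<phi> t d x = t * \<phi> (x + (1 - t) *\<^sub>R d) + (1 - t) * \<phi> (x - t *\<^sub>R d) - \<phi> x"

text \<open>
  The modulus \<open>c\<close> depends on the shape of the segment only, not on its position. This is what makes
  the class translation invariant.
\<close>

definition semiconvex :: "(real \<Rightarrow> 'a \<Rightarrow> real) \<Rightarrow> ('a::real_vector \<Rightarrow> real) \<Rightarrow> bool" where
  "semiconvex c h \<longleftrightarrow> (\<forall>t\<in>{0..1}. \<forall>d x. - c t d \<le> defect h t d x)"

definition envelope :: "(real \<Rightarrow> 'a \<Rightarrow> real) \<Rightarrow> ('a::real_vector \<Rightarrow> real) \<Rightarrow> 'a \<Rightarrow> real" where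
  "envelope c g x = Sup {h x | h. semiconvex c h \<and> (\<forall>z. h z \<le> g z)}"

lemma semiconvex_le_envelope:
  assumes "semiconvex c h" "\<And>z. h z \<le> g z"
  shows "h x \<le> envelope c g x"
  unfolding envelope_def
proof (rule cSup_upper)
  show "h x \<in> {h x | h. semiconvex c h \<and> (\<forall>z. h z \<le> g z)}"
    using assms by blast
  show "bdd_above {h x | h. semiconvex c h \<and> (\<forall>z. h z \<le> g z)}"
    by (rule bdd_aboveI[of _ "g x"]) auto
qed

lemma envelope_least:
  assumes "semiconvex c h0" "\<And>z. h0 z \<le> g z"
    and "\<And>h. semiconvex c h \<Longrightarrow> (\<And>z. h z \<le> g z) \<Longrightarrow> h x \<le> b"
  shows "envelope c g x \<le> b"
  unfolding envelope_def
proof (rule cSup_least)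
  show "{h x | h. semiconvex c h \<and> (\<forall>z. h z \<le> g z)} \<noteq> {}"
    using assms(1,2) by blast
qed (use assms(3) in blast)

lemma envelope_le:
  assumes "semiconvex c h0" "\<And>z. h0 z \<le> g z"
  shows "envelope c g x \<le> g x"
  by (rule envelope_least[OF assms])

text \<open>
  Each competitor satisfies the inequality at \<open>x\<close> with its own values at the ends of the segment, and
  these only grow when they are replaced by those of the envelope.
\<close>

lemma semiconvex_envelope:
  assumes h0: "semiconvex c h0" "\<And>z. h0 z \<le> g z"
  shows "semiconvex c (envelope c g)"
  unfolding semiconvex_def
proof (intro ballI allI)
  fix t :: real and d x :: 'a
  assume t: "t \<in> {0..1}"
  let ?F = "envelope c g"
  have "?F x \<le> t * ?F (x + (1 - t) *\<^sub>R d) + (1 - t) * ?F (x - t *\<^sub>R d) + c t d"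
  proof (rule envelope_least[OF h0])
    fix h assume h: "semiconvex c h" "\<And>z. h z \<le> g z"
    have "h x \<le> t * h (x + (1 - t) *\<^sub>R d) + (1 - t) * h (x - t *\<^sub>R d) + c t d"
      using h(1) t unfolding semiconvex_def defect_def by (smt (verit))
    also have "\<dots> \<le> t * ?F (x + (1 - t) *\<^sub>R d) + (1 - t) * ?F (x - t *\<^sub>R d) + c t d"
      using t by (intro add_mono mult_left_mono semiconvex_le_envelope h order_refl) auto
    finally show "h x \<le> t * ?F (x + (1 - t) *\<^sub>R d) + (1 - t) * ?F (x - t *\<^sub>R d) + c t d" .
  qed
  then show "- c t d \<le> defect ?F t d x"
    unfolding defect_def by linarith
qed

lemma semiconvex_translate:
  assumes "semiconvex c h"
  shows "semiconvex c (\<lambda>x. h (x + v))"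
proof -
  have "defect (\<lambda>x. h (x + v)) t d x = defect h t d (x + v)" for t d x
    by (simp add: defect_def algebra_simps)
  then show ?thesis using assms by (simp add: semiconvex_def)
qed

lemma semiconvex_combination:
  assumes "semiconvex c h" "semiconvex c k" "0 \<le> s" "s \<le> 1"
  shows "semiconvex c (\<lambda>x. s * h x + (1 - s) * k x - b)"
  unfolding semiconvex_def
proof (intro ballI allI)
  fix t :: real and d x :: 'a
  assume t: "t \<in> {0..1}"
  have "- c t d = s * (- c t d) + (1 - s) * (- c t d)"
    by (simp add: algebra_simps)
  also have "\<dots> \<le> s * defect h t d x + (1 - s) * defect k t d x"
    using assms t unfolding semiconvex_def by (intro add_mono mult_left_mono) auto
  also have "\<dots> = defect (\<lambda>x. s * h x + (1 - s) * k x - b) t d x"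
    by (simp add: defect_def algebra_simps)
  finally show "- c t d \<le> defect (\<lambda>x. s * h x + (1 - s) * k x - b) t d x" .
qed

text \<open>
  The main property of the envelope \<open>F\<close>: it inherits semiconcavity from \<open>g\<close>. The average
  \<open>t F(x + (1 - t) d) + (1 - t) F(x - t d) - b\<close>, as a function of \<open>x\<close>, is semiconvex. It lies below \<open>g\<close>
  because \<open>F \<le> g\<close> and the defect of \<open>g\<close> is at most \<open>b\<close>. So it is a competitor in the definition
  of \<open>F\<close>, hence below \<open>F\<close>.
\<close>

lemma defect_envelope_le:
  assumes h0: "semiconvex c h0" "\<And>z. h0 z \<le> g z"
    and t: "0 \<le> t" "t \<le> 1" and g: "\<And>x. defect g t d x \<le> b"
  shows "defect (envelope c g) t d x \<le> b"
proof -
  let ?F = "envelope c g"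
  let ?k = "\<lambda>x. t * ?F (x + (1 - t) *\<^sub>R d) + (1 - t) * ?F (x + - (t *\<^sub>R d)) - b"
  have "?k x \<le> ?F x"
  proof (rule semiconvex_le_envelope)
    show "semiconvex c ?k"
      using semiconvex_combination[OF semiconvex_translate[OF semiconvex_envelope[OF h0]]
          semiconvex_translate[OF semiconvex_envelope[OF h0]] t] .
    fix z
    have "?k z \<le> t * g (z + (1 - t) *\<^sub>R d) + (1 - t) * g (z + - (t *\<^sub>R d)) - b"
      using t by (intro add_mono mult_left_mono envelope_le[OF h0] diff_right_mono) auto
    also have "\<dots> \<le> g z"
      using g[of z] by (simp add: defect_def)
    finally show "?k z \<le> g z" .
  qed
  then show ?thesis by (simp add: defect_def)
qed

text \<open>
  The same comparison with a single translate: \<open>F(x + v) - L \<parallel>v\<parallel>\<close> is semiconvex and below \<open>g\<close>.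
\<close>

lemma lipschitz_envelope:
  fixes g :: "'a::real_normed_vector \<Rightarrow> real"
  assumes h0: "semiconvex c h0" "\<And>z. h0 z \<le> g z" and g: "L-lipschitz_on UNIV g"
  shows "L-lipschitz_on UNIV (envelope c g)"
proof -
  let ?F = "envelope c g"
  have *: "?F y \<le> ?F x + L * norm (y - x)" for x y
  proof -
    let ?k = "\<lambda>z. ?F (z + (y - x)) - L * norm (y - x)"
    have "?k x \<le> ?F x"
    proof (rule semiconvex_le_envelope[of c ?k])
      show "semiconvex c ?k"
        using semiconvex_combination[where s = 1 and b = "L * norm (y - x)",
            OF semiconvex_translate[OF semiconvex_envelope[OF h0], of "y - x"]
              semiconvex_envelope[OF h0]] by simp
      fix z
      have "\<bar>g (z + (y - x)) - g z\<bar> \<le> L * norm (y - x)"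
        using lipschitz_onD[OF g, of "z + (y - x)" z] by (simp add: dist_norm)
      then show "?k z \<le> g z"
        using envelope_le[OF h0, of "z + (y - x)"] by linarith
    qed
    then show ?thesis by simp
  qed
  show ?thesis
  proof (rule lipschitz_onI)
    show "dist (?F x) (?F y) \<le> L * dist x y" for x y
      using *[of x y] *[of y x] by (simp add: dist_norm norm_minus_commute abs_le_iff)
  qed (rule lipschitz_on_nonneg[OF g])
qed

section \<open>Small defects imply uniform differentiability\<close>

text \<open>
  Expanding \<open>F (y + v)\<close> about \<open>y\<close> and about \<open>x\<close>, and \<open>F y\<close> about \<open>x\<close>, bounds
  \<open>(A y - A x) v\<close> by the sum of three remainders. For \<open>\<parallel>v\<parallel> = \<parallel>y - x\<parallel>\<close> these are all of the order
  \<open>\<epsilon> \<parallel>v\<parallel>\<close>, which bounds the operator norm of \<open>A y - A x\<close>.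
\<close>

lemma C1plus_if_uniform_Taylor:
  fixes F :: "'a::real_normed_vector \<Rightarrow> real" and A :: "'a \<Rightarrow> 'a \<Rightarrow>\<^sub>L real"
  assumes T: "\<And>\<epsilon>. \<epsilon> > 0 \<Longrightarrow> \<exists>\<delta>>0. \<forall>x v. norm v < \<delta> \<longrightarrow> \<bar>F (x + v) - F x - A x v\<bar> \<le> \<epsilon> * norm v"
  shows "F \<in> C1plus UNIV"
proof -
  have der: "(F has_derivative blinfun_apply (A x)) (at x)" for x
    unfolding has_derivative_at_alt
  proof (intro conjI allI impI)
    fix e :: real assume "e > 0"
    from T[OF this] obtain \<delta> where \<delta>: "\<delta> > 0"
      and T': "\<And>x v. norm v < \<delta> \<Longrightarrow> \<bar>F (x + v) - F x - A x v\<bar> \<le> e * norm v" by blast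
    have "norm (F y - F x - A x (y - x)) \<le> e * norm (y - x)" if "norm (y - x) < \<delta>" for y
      using T'[OF that, of x] by simp
    with \<delta> show "\<exists>d>0. \<forall>y. norm (y - x) < d \<longrightarrow> norm (F y - F x - A x (y - x)) \<le> e * norm (y - x)"
      by blast
  qed (rule blinfun.bounded_linear_right)
  have DF: "DF F = A"
    by (rule ext) (simp add: DF_def frechet_derivative_at[OF der, symmetric] blinfun_apply_inverse)
  have "uniformly_continuous_on UNIV A"
    unfolding uniformly_continuous_on_def
  proof (intro allI impI)
    fix e :: real assume "e > 0"
    then have "e / 8 > 0" by simp
    from T[OF this] obtain \<delta> where \<delta>: "\<delta> > 0"
      and T': "\<And>x v. norm v < \<delta> \<Longrightarrow> \<bar>F (x + v) - F x - A x v\<bar> \<le> e / 8 * norm v" by blast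
    show "\<exists>d>0. \<forall>x\<in>UNIV. \<forall>x'\<in>UNIV. dist x' x < d \<longrightarrow> dist (A x') (A x) < e"
    proof (intro exI[of _ "\<delta> / 2"] conjI ballI impI)
      fix x y :: 'a assume xy: "dist y x < \<delta> / 2"
      define r where "r = norm (y - x)"
      have r: "0 \<le> r" "2 * r < \<delta>" using xy by (auto simp: r_def dist_norm)
      have small: "\<bar>(A y - A x) v\<bar> \<le> e / 2 * r" if v: "norm v = r" for v
      proof -
        have n2: "norm (y - x + v) \<le> 2 * r"
          using norm_triangle_ineq[of "y - x" v] v by (simp add: r_def)
        have "\<bar>F (x + (y - x + v)) - F x - A x (y - x + v)\<bar> \<le> e / 8 * (2 * r)"
          using T'[of "y - x + v" x] n2 r \<open>e > 0\<close>
          by (smt (verit) divide_pos_pos mult_left_mono)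
        moreover have "\<bar>F (x + (y - x)) - F x - A x (y - x)\<bar> \<le> e / 8 * r"
          using T'[of "y - x" x] r unfolding r_def by linarith
        moreover have "\<bar>F (y + v) - F y - A y v\<bar> \<le> e / 8 * r"
          using T'[of v y] r v by simp
        moreover have "x + (y - x + v) = y + v" "x + (y - x) = y" by simp_all
        ultimately show ?thesis
          by (simp only: blinfun.bilinear_simps)
      qed
      have "norm (A y - A x) \<le> e / 2"
      proof (rule norm_blinfun_bound)
        fix v
        show "norm ((A y - A x) v) \<le> e / 2 * norm v"
        proof (cases "v = 0 \<or> r = 0")
          case False
          then have "\<bar>(A y - A x) ((r / norm v) *\<^sub>R v)\<bar> \<le> e / 2 * r"
            using r by (intro small) simp
          then have "r / norm v * \<bar>(A y - A x) v\<bar> \<le> e / 2 * r"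
            using r by (simp add: blinfun.scaleR_right abs_mult)
          then show ?thesis using False r by (simp add: field_simps)
        next
          case True
          then have "v = 0 \<or> y = x" by (simp add: r_def)
          then show ?thesis using \<open>e > 0\<close> by (auto simp: blinfun.bilinear_simps)
        qed
      qed (use \<open>e > 0\<close> in simp)
      then show "dist (A y) (A x) < e" using \<open>e > 0\<close> by (simp add: dist_norm)
    qed (use \<delta> in simp)
  qed
  then show ?thesis
    using der DF unfolding C1plus_def differentiable_def by auto
qed

text \<open>
  The difference quotients along \<open>v\<close> with steps \<open>1 / n\<close> form a Cauchy sequence: two of them differ by
  a defect on a segment that starts at \<open>x\<close>, divided by the smaller step. Here the factor \<open>t\<close> in the bound
  of the defect cancels the division. Let \<open>D v\<close> be the limit. Passing to the limit in the defects on
  short segments from \<open>x + u / n\<close> to \<open>x + w / n\<close> shows that \<open>D\<close> is affine. As \<open>D 0 = 0\<close>, it is linear,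
  and it is bounded because \<open>F\<close> is Lipschitz. The Cauchy estimate between the first quotient and the
  limit is the Taylor estimate. The linear map depends on \<open>x\<close>, but the pair \<open>\<epsilon>\<close>, \<open>\<delta>\<close> does not:
  it is the one for which the defect bound holds.
\<close>

lemma uniform_Taylor_if_small_defects:
  fixes F :: "'a::real_normed_vector \<Rightarrow> real"
  assumes L: "L-lipschitz_on UNIV F"
    and small: "\<And>\<epsilon>. \<epsilon> > 0 \<Longrightarrow> \<exists>\<delta>>0. \<forall>t\<in>{0..1}. \<forall>d x. norm d < \<delta> \<longrightarrow> \<bar>defect F t d x\<bar> \<le> \<epsilon> * (t * (1 - t) * norm d)"
  shows "\<exists>A :: 'a \<Rightarrow>\<^sub>L real. \<forall>\<epsilon> \<delta> v. 
     (\<forall>t\<in>{0..1}. \<forall>d x. norm d < \<delta> \<longrightarrow> \<bar>defect F t d x\<bar> \<le> \<epsilon> * (t * (1 - t) * norm d))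
     \<longrightarrow> \<epsilon> > 0 \<longrightarrow> norm v < \<delta> \<longrightarrow> \<bar>F (x + v) - F x - A v\<bar> \<le> \<epsilon> * norm v"
proof -
  define q where "q n v = real (Suc n) * (F (x + v /\<^sub>R real (Suc n)) - F x)" for n v
  let ?small = "\<lambda>\<epsilon> \<delta>. \<forall>t\<in>{0..1}. \<forall>d x. norm d < \<delta> \<longrightarrow> \<bar>defect F t d x\<bar> \<le> \<epsilon> * (t * (1 - t) * norm d)"
  have q_near: "\<bar>q n v - q m v\<bar> \<le> \<epsilon> * norm v"
    if "?small \<epsilon> \<delta>" "\<epsilon> > 0" "norm v < \<delta> * Suc m" "m \<le> n" for \<epsilon> \<delta> v m n
  proof -
    let ?m = "real (Suc m)" and ?n = "real (Suc n)"
    define t where "t = ?m / ?n"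
    have t: "0 \<le> t" "t \<le> 1" using that(4) by (auto simp: t_def)
    define d where "d = v /\<^sub>R ?m"
    have nd: "norm d = norm v / ?m" by (simp add: d_def divide_inverse mult.commute)
    have "norm d < \<delta>" unfolding nd using that(3) by (simp add: pos_divide_less_eq del: of_nat_Suc)
    then have "\<bar>defect F t d (x + t *\<^sub>R d)\<bar> \<le> \<epsilon> * (t * (1 - t) * norm d)"
      using that(1) t by auto
    also have "\<dots> \<le> \<epsilon> * (t * 1 * norm d)"
      using t \<open>\<epsilon> > 0\<close> by (intro mult_left_mono mult_right_mono) auto
    also have "\<dots> = \<epsilon> * norm v / ?n"
      by (simp add: t_def nd del: of_nat_Suc)
    finally have "?n * \<bar>defect F t d (x + t *\<^sub>R d)\<bar> \<le> ?n * (\<epsilon> * norm v / ?n)"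
      by (intro mult_left_mono) auto
    then have a: "\<bar>?n * defect F t d (x + t *\<^sub>R d)\<bar> \<le> \<epsilon> * norm v"
      by (simp add: abs_mult del: of_nat_Suc)
    have e1: "x + t *\<^sub>R d + (1 - t) *\<^sub>R d = x + v /\<^sub>R ?m"
      by (simp add: d_def algebra_simps del: of_nat_Suc)
    have e2: "t *\<^sub>R d = v /\<^sub>R ?n"
      by (simp add: t_def d_def divide_inverse del: of_nat_Suc)
    have "?n * defect F t d (x + t *\<^sub>R d) = ?n * (t * F (x + v /\<^sub>R ?m) + (1 - t) * F x - F (x + v /\<^sub>R ?n))"
      unfolding defect_def e1 by (simp only: e2 add_diff_cancel)
    also have "\<dots> = (?n * t) * (F (x + v /\<^sub>R ?m) - F x) - ?n * (F (x + v /\<^sub>R ?n) - F x)"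
      by (simp only: algebra_simps)
    also have "?n * t = ?m" by (simp add: t_def del: of_nat_Suc)
    finally have "?n * defect F t d (x + t *\<^sub>R d) = q m v - q n v" by (simp only: q_def)
    with a show ?thesis by (simp add: abs_minus_commute)
  qed
  have eventually_small: "\<exists>m. r < \<delta> * real (Suc m)" if "\<delta> > 0" for r \<delta> :: real
  proof -
    obtain m where "r / \<delta> < real m" using reals_Archimedean2 by blast
    then have "r / \<delta> < real (Suc m)" by simp
    with that show ?thesis by (intro exI[of _ m]) (simp add: pos_divide_less_eq mult.commute del: of_nat_Suc)
  qed
  have "Cauchy (\<lambda>n. q n v)" for v
  proof (rule CauchyI')
    fix e :: real assume "e > 0"
    then have "e / (1 + norm v) > 0" by (simp add: add_pos_nonneg)
    from small[OF this] obtain \<delta> where \<delta>: "\<delta> > 0" "?small (e / (1 + norm v)) \<delta>" by blast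
    obtain m where m: "norm v < \<delta> * real (Suc m)" using eventually_small[OF \<delta>(1)] by blast
    have "dist (q k v) (q n v) < e" if "m \<le> k" "k < n" for k n
    proof -
      have "\<delta> * real (Suc m) \<le> \<delta> * real (Suc k)" using \<delta>(1) that by simp
      then have "\<bar>q n v - q k v\<bar> \<le> e / (1 + norm v) * norm v"
        using m that by (intro q_near[OF \<delta>(2) \<open>e / (1 + norm v) > 0\<close>]) auto
      also have "\<dots> < e"
        using \<open>e > 0\<close> by (simp add: add_pos_nonneg field_simps)
      finally show ?thesis by (simp add: dist_norm abs_minus_commute)
    qed
    then show "\<exists>M. \<forall>m\<ge>M. \<forall>n>m. dist (q m v) (q n v) < e" by blast
  qed
  then have "\<exists>D. \<forall>v. (\<lambda>n. q n v) \<longlonglongrightarrow> D v"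
    by (intro choice) (simp add: Cauchy_convergent_iff convergent_def)
  then obtain D where D: "\<And>v. (\<lambda>n. q n v) \<longlonglongrightarrow> D v" by blast
  have D0: "D 0 = 0"
    using D[of 0] by (simp add: q_def LIMSEQ_const_iff)
  have D_bound: "\<bar>D v\<bar> \<le> norm v * L" for v
  proof (rule LIMSEQ_le_const2[OF tendsto_rabs[OF D]], intro exI allI impI)
    fix n
    have "\<bar>F (x + v /\<^sub>R real (Suc n)) - F x\<bar> \<le> L * (norm v / real (Suc n))"
      using lipschitz_onD[OF L, of "x + v /\<^sub>R real (Suc n)" x]
      by (simp add: dist_norm divide_inverse mult.commute del: of_nat_Suc)
    then have "real (Suc n) * \<bar>F (x + v /\<^sub>R real (Suc n)) - F x\<bar> \<le> real (Suc n) * (L * (norm v / real (Suc n)))"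
      by (intro mult_left_mono) auto
    then show "\<bar>q n v\<bar> \<le> norm v * L"
      by (simp add: q_def abs_mult mult.commute del: of_nat_Suc)
  qed
  have affine: "D (t *\<^sub>R u + (1 - t) *\<^sub>R w) = t * D u + (1 - t) * D w" if t: "0 \<le> t" "t \<le> 1" for t u w
  proof -
    let ?z = "t *\<^sub>R u + (1 - t) *\<^sub>R w"
    have "(\<lambda>n. t * q n u + (1 - t) * q n w - q n ?z) \<longlonglongrightarrow> t * D u + (1 - t) * D w - D ?z"
      by (intro tendsto_intros D)
    moreover have "(\<lambda>n. t * q n u + (1 - t) * q n w - q n ?z) \<longlonglongrightarrow> 0"
    proof (rule LIMSEQ_I)
      fix e :: real assume "e > 0"
      let ?e = "e / (1 + norm (u - w))"
      have "?e > 0" using \<open>e > 0\<close> by (simp add: add_pos_nonneg)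
      from small[OF this] obtain \<delta> where \<delta>: "\<delta> > 0" "?small ?e \<delta>" by blast
      obtain m where m: "norm (u - w) < \<delta> * real (Suc m)" using eventually_small[OF \<delta>(1)] by blast
      have "norm (t * q n u + (1 - t) * q n w - q n ?z - 0) < e" if "m \<le> n" for n
      proof -
        let ?n = "real (Suc n)"
        define d where "d = (u - w) /\<^sub>R ?n"
        have nd: "norm d = norm (u - w) / ?n" by (simp add: d_def divide_inverse mult.commute)
        have "\<delta> * real (Suc m) \<le> \<delta> * ?n" using \<delta>(1) that by simp
        then have "norm d < \<delta>"
          unfolding nd using m by (simp add: pos_divide_less_eq del: of_nat_Suc)
        then have "\<bar>defect F t d (x + ?z /\<^sub>R ?n)\<bar> \<le> ?e * (t * (1 - t) * norm d)"
          using \<delta>(2) t by auto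
        also have "\<dots> \<le> ?e * (1 * norm d)"
          using t \<open>?e > 0\<close> by (intro mult_left_mono mult_right_mono mult_le_one) auto
        finally have "?n * \<bar>defect F t d (x + ?z /\<^sub>R ?n)\<bar> \<le> ?n * (?e * (1 * norm d))"
          by (intro mult_left_mono) auto
        then have "\<bar>?n * defect F t d (x + ?z /\<^sub>R ?n)\<bar> \<le> ?e * norm (u - w)"
          by (simp add: abs_mult nd del: of_nat_Suc)
        also have "\<dots> < e"
          using \<open>e > 0\<close> by (simp add: add_pos_nonneg field_simps)
        finally have a: "\<bar>?n * defect F t d (x + ?z /\<^sub>R ?n)\<bar> < e" .
        have "x + ?z /\<^sub>R ?n + (1 - t) *\<^sub>R d = x + (?z + (1 - t) *\<^sub>R (u - w)) /\<^sub>R ?n"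
          unfolding d_def by (simp only: scaleR_add_right scaleR_left_commute add.assoc)
        also have "?z + (1 - t) *\<^sub>R (u - w) = u" by (simp add: algebra_simps)
        finally have e1: "x + ?z /\<^sub>R ?n + (1 - t) *\<^sub>R d = x + u /\<^sub>R ?n" .
        have "x + ?z /\<^sub>R ?n - t *\<^sub>R d = x + (?z - t *\<^sub>R (u - w)) /\<^sub>R ?n"
          unfolding d_def by (simp only: scaleR_diff_right scaleR_left_commute add_diff_eq)
        also have "?z - t *\<^sub>R (u - w) = w" by (simp add: algebra_simps)
        finally have e2: "x + ?z /\<^sub>R ?n - t *\<^sub>R d = x + w /\<^sub>R ?n" .
        have "?n * defect F t d (x + ?z /\<^sub>R ?n) = t * q n u + (1 - t) * q n w - q n ?z"
          unfolding defect_def e1 e2 q_def by (simp only: algebra_simps)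
        with a show ?thesis by simp
      qed
      then show "\<exists>m. \<forall>n\<ge>m. norm (t * q n u + (1 - t) * q n w - q n ?z - 0) < e" by blast
    qed
    ultimately show ?thesis using LIMSEQ_unique by force
  qed
  have scale01: "D (t *\<^sub>R u) = t * D u" if "0 \<le> t" "t \<le> 1" for t u
    using affine[OF that, of u 0] D0 by simp
  have add: "D (u + w) = D u + D w" for u w
  proof -
    have "1/2 * D (u + w) = D ((1/2) *\<^sub>R (u + w))" by (rule scale01[symmetric]) auto
    also have "\<dots> = 1/2 * D u + 1/2 * D w"
      using affine[of "1/2" u w] by (simp add: scaleR_add_right)
    finally show ?thesis by simp
  qed
  have neg: "D (- u) = - D u" for u using add[of u "- u"] D0 by simp
  have pos: "D (t *\<^sub>R u) = t * D u" if "0 \<le> t" for t u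
  proof (cases "t \<le> 1")
    case False
    then have "D ((1 / t) *\<^sub>R (t *\<^sub>R u)) = (1 / t) * D (t *\<^sub>R u)" by (intro scale01) auto
    with False show ?thesis by (simp add: field_simps)
  qed (use that scale01 in auto)
  have scale: "D (t *\<^sub>R u) = t * D u" for t u
    using pos[of t u] pos[of "- t" u] neg[of "t *\<^sub>R u"] by (cases "0 \<le> t") auto
  have bl: "bounded_linear D"
    using D_bound by (intro bounded_linear_intro[where K = L]) (auto simp: add scale)
  show ?thesis
  proof (intro exI[of _ "Blinfun D"] allI impI)
    fix \<epsilon> \<delta> and v :: 'a assume *: "?small \<epsilon> \<delta>" "\<epsilon> > 0" "norm v < \<delta>"
    have "\<bar>q 0 v - D v\<bar> \<le> \<epsilon> * norm v"
    proof (rule LIMSEQ_le_const2[of "\<lambda>n. \<bar>q 0 v - q n v\<bar>"])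
      show "(\<lambda>n. \<bar>q 0 v - q n v\<bar>) \<longlonglongrightarrow> \<bar>q 0 v - D v\<bar>" by (intro tendsto_intros D)
      show "\<exists>N. \<forall>n\<ge>N. \<bar>q 0 v - q n v\<bar> \<le> \<epsilon> * norm v"
        using q_near[OF *(1,2), of v 0] *(3) by (auto simp: abs_minus_commute)
    qed
    then show "\<bar>F (x + v) - F x - Blinfun D v\<bar> \<le> \<epsilon> * norm v"
      by (simp add: q_def bounded_linear_Blinfun_apply[OF bl])
  qed
qed

lemma C1plus_if_small_defects:
  fixes F :: "'a::real_normed_vector \<Rightarrow> real"
  assumes L: "L-lipschitz_on UNIV F"
    and small: "\<And>\<epsilon>. \<epsilon> > 0 \<Longrightarrow> \<exists>\<delta>>0. \<forall>t\<in>{0..1}. \<forall>d x. norm d < \<delta> \<longrightarrow> \<bar>defect F t d x\<bar> \<le> \<epsilon> * (t * (1 - t) * norm d)"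
  shows "F \<in> C1plus UNIV"
proof -
  let ?small = "\<lambda>\<epsilon> \<delta>. \<forall>t\<in>{0..1}. \<forall>d x. norm d < \<delta> \<longrightarrow> \<bar>defect F t d x\<bar> \<le> \<epsilon> * (t * (1 - t) * norm d)"
  have "\<forall>x. \<exists>A :: 'a \<Rightarrow>\<^sub>L real. \<forall>\<epsilon> \<delta> v. ?small \<epsilon> \<delta> \<longrightarrow> \<epsilon> > 0 \<longrightarrow> norm v < \<delta>
      \<longrightarrow> \<bar>F (x + v) - F x - A v\<bar> \<le> \<epsilon> * norm v"
    using uniform_Taylor_if_small_defects[OF L small] by blast
  from choice[OF this] obtain A :: "'a \<Rightarrow> 'a \<Rightarrow>\<^sub>L real" where A: "\<And>x \<epsilon> \<delta> v. ?small \<epsilon> \<delta> \<Longrightarrow> \<epsilon> > 0 \<Longrightarrow> norm v < \<delta>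
      \<Longrightarrow> \<bar>F (x + v) - F x - A x v\<bar> \<le> \<epsilon> * norm v"
    by blast
  show ?thesis
  proof (rule C1plus_if_uniform_Taylor[of F A])
    fix \<epsilon> :: real assume e: "\<epsilon> > 0"
    from small[OF e] obtain \<delta> where \<delta>: "\<delta> > 0" "?small \<epsilon> \<delta>" by blast
    show "\<exists>\<delta>>0. \<forall>x v. norm v < \<delta> \<longrightarrow> \<bar>F (x + v) - F x - A x v\<bar> \<le> \<epsilon> * norm v"
      using \<delta>(1) A[OF \<delta>(2) e] by (intro exI[of _ \<delta>]) blast
  qed
qed

section \<open>The Whitney extension\<close>

text \<open>
  Two jets differ at \<open>x\<close> by \<open>f y - f z - G z (y - z) + (G y - G z) (x - y)\<close>. Let \<open>s\<close> be the larger of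
  \<open>\<parallel>x - y\<parallel>\<close> and \<open>\<parallel>x - z\<parallel>\<close>, so that \<open>\<parallel>y - z\<parallel> \<le> 2 s\<close>. If \<open>\<parallel>y - z\<parallel>\<close> is below the threshold
  belonging to \<open>\<epsilon> j\<close>, the difference is at most \<open>3 s \<epsilon> j\<close>; in any case it is at most \<open>M s\<close>. The
  gauge is chosen above the cones that correspond to these thresholds.
\<close>

lemma gauge_separates_jets:
  fixes E :: "'a::banach set" and f :: "'a \<Rightarrow> real" and G :: "'a \<Rightarrow> 'a \<Rightarrow>\<^sub>L real"
  assumes sr: "super_reflexive TYPE('a)"
    and f: "L-lipschitz_on E f" and G: "bounded (G ` E)" and W: "condition_W E f G"
  obtains \<psi> :: "'a \<Rightarrow> real" and K where
    "smooth_convex_gauge \<psi> K"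
    "\<And>x y z. y \<in> E \<Longrightarrow> z \<in> E \<Longrightarrow> f y + G y (x - y) - \<psi> (x - y) \<le> f z + G z (x - z) + \<psi> (x - z)"
proof -
  obtain B where B: "B > 0" "\<And>x. x \<in> E \<Longrightarrow> norm (G x) \<le> B"
    using G by (auto simp: bounded_pos)
  have L: "0 \<le> L" by (rule lipschitz_on_nonneg[OF f])
  define M where "M = 2 * L + 2 * B"
  have M: "M > 0" using B L by (simp add: M_def)
  define \<epsilon> where "\<epsilon> k = M * (1/2)^Suc k / 3" for k
  have \<epsilon>: "\<epsilon> k > 0" for k using M by (simp add: \<epsilon>_def)
  have "\<exists>\<delta>>0. \<forall>y\<in>E. \<forall>z\<in>E. norm (y - z) < 2 * \<delta> \<longrightarrow>
      norm (G y - G z) \<le> \<epsilon> k \<and> \<bar>f y - f z - G z (y - z)\<bar> \<le> \<epsilon> k * norm (y - z)" for k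
  proof -
    obtain d where d: "d > 0" "\<forall>z\<in>E. \<forall>y\<in>E. dist y z < d \<longrightarrow> dist (G y) (G z) < \<epsilon> k"
      using W \<epsilon>[of k] unfolding condition_W_def uniformly_continuous_on_def by blast
    obtain d' where d': "d' > 0"
      "\<forall>z\<in>E. \<forall>y\<in>E. norm (y - z) < d' \<longrightarrow> \<bar>f y - f z - G z (y - z)\<bar> \<le> \<epsilon> k * norm (y - z)"
      using W \<epsilon>[of k] unfolding condition_W_def by blast
    show ?thesis
      using d d' by (intro exI[of _ "min d d' / 2"]) (auto simp: dist_norm less_imp_le)
  qed
  then obtain \<delta> where \<delta>: "\<And>k. \<delta> k > 0" and
    close: "\<And>k y z. y \<in> E \<Longrightarrow> z \<in> E \<Longrightarrow> norm (y - z) < 2 * \<delta> k \<Longrightarrow>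
      norm (G y - G z) \<le> \<epsilon> k \<and> \<bar>f y - f z - G z (y - z)\<bar> \<le> \<epsilon> k * norm (y - z)" by metis
  \<comment> \<open>The second argument of the minimum makes the radii tend to 0, so that every positive s exceeds one of them.\<close>
  define r where "r k = min (\<delta> k) (1 / real (Suc k))" for k
  have r: "0 < r k" for k using \<delta> by (simp add: r_def)
  obtain \<psi> :: "'a \<Rightarrow> real" and K where gauge: "smooth_convex_gauge \<psi> K"
    and big: "\<And>k v. r k \<le> norm v \<Longrightarrow> M * (1/2)^k * norm v \<le> \<psi> v"
    by (rule smooth_convex_gauge_above_cones[where r = r, OF sr M]) (use r that in blast)+
  have \<psi>: "\<psi> 0 = 0" "\<And>x. 0 \<le> \<psi> x" using gauge by (auto simp: smooth_convex_gauge_def)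
  show ?thesis
  proof (rule that[OF gauge])
    fix x y z assume yz: "y \<in> E" "z \<in> E"
    define s where "s = max (norm (x - y)) (norm (x - z))"
    have s: "norm (x - y) \<le> s" "norm (x - z) \<le> s" by (auto simp: s_def)
    have yz_s: "norm (y - z) \<le> 2 * s"
      using norm_triangle_ineq4[of "x - z" "x - y"] s by simp
    have \<psi>_sum: "M * (1/2)^k * s \<le> \<psi> (x - y) + \<psi> (x - z)" if "r k \<le> s" for k
      using that big[of k "x - y"] big[of k "x - z"] \<psi>(2)[of "x - y"] \<psi>(2)[of "x - z"]
      by (auto simp: s_def max_def split: if_splits)
    have "f y + G y (x - y) - (f z + G z (x - z)) \<le> \<psi> (x - y) + \<psi> (x - z)"
    proof (cases "s = 0")
      case True
      then have "x = y" "x = z" using s by auto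
      then show ?thesis using \<psi>(1) by simp
    next
      case False
      then have "s > 0" using s(1) norm_ge_zero[of "x - y"] by linarith
      have ex: "\<exists>k. r k \<le> s"
      proof -
        obtain k where "inverse (real (Suc k)) < s" using reals_Archimedean[OF \<open>s > 0\<close>] by blast
        then show ?thesis by (intro exI[of _ k]) (simp add: r_def inverse_eq_divide)
      qed
      define k where "k = (LEAST k. r k \<le> s)"
      have k: "r k \<le> s" unfolding k_def using ex by (rule LeastI_ex)
      show ?thesis
      proof (cases k)
        case 0
        have "f y - f z \<le> L * norm (y - z)"
          using lipschitz_onD[OF f yz] by (simp add: dist_norm)
        also have "\<dots> \<le> L * (2 * s)" using L yz_s by (intro mult_left_mono)
        finally have 1: "f y - f z \<le> 2 * L * s" by simp
        have 2: "\<bar>G u (x - u)\<bar> \<le> B * s" if "u \<in> E" "norm (x - u) \<le> s" for u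
          using order_trans[OF norm_blinfun mult_mono[OF B(2)[OF that(1)] that(2)]] B(1) by simp
        have "f y + G y (x - y) - (f z + G z (x - z)) \<le> M * s"
          using 1 2[OF yz(1) s(1)] 2[OF yz(2) s(2)] by (simp add: M_def algebra_simps)
        then show ?thesis using \<psi>_sum[OF k] 0 by simp
      next
        case (Suc j)
        then have "\<not> r j \<le> s" unfolding k_def using not_less_Least[of j "\<lambda>k. r k \<le> s"] by (simp add: k_def)
        then have "norm (y - z) < 2 * \<delta> j" using yz_s by (simp add: r_def)
        from close[OF yz this] have c: "norm (G y - G z) \<le> \<epsilon> j" "\<bar>f y - f z - G z (y - z)\<bar> \<le> \<epsilon> j * norm (y - z)"
          by auto
        have "f y - f z - G z (y - z) \<le> \<epsilon> j * (2 * s)"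
          using c(2) mult_left_mono[OF yz_s, of "\<epsilon> j"] \<epsilon>[of j] by linarith
        moreover have "(G y - G z) (x - y) \<le> \<epsilon> j * s"
          using order_trans[OF norm_blinfun mult_mono[OF c(1) s(1)]] \<epsilon>[of j] by (simp add: less_imp_le abs_le_iff)
        moreover have "f y + G y (x - y) - (f z + G z (x - z)) = f y - f z - G z (y - z) + (G y - G z) (x - y)"
          by (simp add: blinfun.bilinear_simps)
        ultimately have "f y + G y (x - y) - (f z + G z (x - z)) \<le> 3 * \<epsilon> j * s" by (simp add: algebra_simps)
        also have "\<dots> = M * (1/2)^k * s" by (simp add: \<epsilon>_def Suc)
        finally show ?thesis using \<psi>_sum[OF k] by simp
      qed
    qed
    then show "f y + G y (x - y) - \<psi> (x - y) \<le> f z + G z (x - z) + \<psi> (x - z)" by simp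
  qed
qed

text \<open>
  On a segment, a convex function lies below its chords from \<open>x\<close> to \<open>x + d\<close> and to \<open>x - d\<close>, so its
  defect for every \<open>t\<close> is controlled by the second difference with step \<open>d\<close>. Convexity of the gauge is
  used here, and this is why second differences suffice to describe smoothness.
\<close>

lemma defect_convex_le:
  fixes \<psi> :: "'a::real_vector \<Rightarrow> real"
  assumes conv: "convex_on UNIV \<psi>" and t: "0 \<le> t" "t \<le> 1"
  shows "defect \<psi> t d x \<le> t * (1 - t) * (\<psi> (x + d) + \<psi> (x - d) - 2 * \<psi> x)"
proof -
  have 1: "\<psi> (x + (1 - t) *\<^sub>R d) \<le> (1 - t) * \<psi> (x + d) + t * \<psi> x"
    using convex_onD[OF conv, of t "x + d" x] t by (simp add: algebra_simps)
  have 2: "\<psi> (x - t *\<^sub>R d) \<le> t * \<psi> (x - d) + (1 - t) * \<psi> x"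
    using convex_onD[OF conv, of "1 - t" "x - d" x] t by (simp add: algebra_simps)
  have "defect \<psi> t d x \<le> t * ((1 - t) * \<psi> (x + d) + t * \<psi> x) + (1 - t) * (t * \<psi> (x - d) + (1 - t) * \<psi> x) - \<psi> x"
    unfolding defect_def using t by (intro diff_right_mono add_mono mult_left_mono 1 2) auto
  also have "\<dots> = t * (1 - t) * (\<psi> (x + d) + \<psi> (x - d) - 2 * \<psi> x)"
    by (simp add: algebra_simps)
  finally show ?thesis .
qed

text \<open>
  The extension is the semiconvex envelope of the infimum \<open>g\<close> of the upper barriers. Its modulus is
  the largest defect of \<open>\<psi>\<close> over all positions of a segment: affine functions have no defect, so this
  bounds the defects of the upper barriers, hence that of \<open>g\<close>, from above, and those of the lower
  barriers from below by its negative.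
\<close>

lemma extension_of_separated_jets:
  fixes E :: "'a::real_normed_vector set" and f :: "'a \<Rightarrow> real" and G :: "'a \<Rightarrow> 'a \<Rightarrow>\<^sub>L real" and \<psi> :: "'a \<Rightarrow> real"
  assumes E: "E \<noteq> {}" and G: "bounded (G ` E)"
    and gauge: "smooth_convex_gauge \<psi> K"
    and compat: "\<And>x y z. y \<in> E \<Longrightarrow> z \<in> E \<Longrightarrow> f y + G y (x - y) - \<psi> (x - y) \<le> f z + G z (x - z) + \<psi> (x - z)"
  obtains F B where "\<And>x. x \<in> E \<Longrightarrow> F x = f x" "B-lipschitz_on UNIV F" "F \<in> C1plus UNIV"
    "\<And>x. x \<in> E \<Longrightarrow> DF F x = G x"
proof -
  obtain M where M: "M > 0" "\<And>x. x \<in> E \<Longrightarrow> norm (G x) \<le> M"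
    using G by (auto simp: bounded_pos)
  have \<psi>: "\<psi> 0 = 0" "\<And>x. 0 \<le> \<psi> x" "K-lipschitz_on UNIV \<psi>" and conv: "convex_on UNIV \<psi>"
    and smooth: "\<And>\<epsilon>. \<epsilon> > 0 \<Longrightarrow> \<exists>\<delta>>0. \<forall>x h. norm h < \<delta> \<longrightarrow> \<psi> (x + h) + \<psi> (x - h) - 2 * \<psi> x \<le> \<epsilon> * norm h"
    using gauge by (auto simp: smooth_convex_gauge_def)
  have K: "0 \<le> K" by (rule lipschitz_on_nonneg[OF \<psi>(3)])
  define c where "c t d = (SUP x. defect \<psi> t d x)" for t d
  have \<psi>_lip: "\<bar>\<psi> x - \<psi> y\<bar> \<le> K * norm (x - y)" for x y
    using lipschitz_onD[OF \<psi>(3)] by (simp add: dist_norm)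
  have bdd: "bdd_above (range (defect \<psi> t d))" if "0 \<le> t" "t \<le> 1" for t d
  proof (rule bdd_aboveI2)
    fix x
    have "\<psi> (x + d) + \<psi> (x - d) - 2 * \<psi> x \<le> 2 * K * norm d"
      using \<psi>_lip[of "x + d" x] \<psi>_lip[of "x - d" x] by simp
    then have "t * (1 - t) * (\<psi> (x + d) + \<psi> (x - d) - 2 * \<psi> x) \<le> t * (1 - t) * (2 * K * norm d)"
      using that by (intro mult_left_mono) auto
    with defect_convex_le[OF conv that, where d = d and x = x]
    show "defect \<psi> t d x \<le> t * (1 - t) * (2 * K * norm d)" by simp
  qed
  have defect_c: "defect \<psi> t d x \<le> c t d" if "0 \<le> t" "t \<le> 1" for t d x
    unfolding c_def by (intro cSUP_upper bdd that) simp
  have c_small: "\<exists>\<delta>>0. \<forall>t\<in>{0..1}. \<forall>d. norm d < \<delta> \<longrightarrow> c t d \<le> \<epsilon> * (t * (1 - t) * norm d)"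
    if "\<epsilon> > 0" for \<epsilon>
  proof -
    from smooth[OF that] obtain \<delta> where \<delta>: "\<delta> > 0"
      "\<And>x h. norm h < \<delta> \<Longrightarrow> \<psi> (x + h) + \<psi> (x - h) - 2 * \<psi> x \<le> \<epsilon> * norm h" by blast
    have "c t d \<le> \<epsilon> * (t * (1 - t) * norm d)" if t: "t \<in> {0..1}" and d: "norm d < \<delta>" for t d
      unfolding c_def
    proof (rule cSUP_least)
      fix x
      have "defect \<psi> t d x \<le> t * (1 - t) * (\<psi> (x + d) + \<psi> (x - d) - 2 * \<psi> x)"
        using t by (intro defect_convex_le[OF conv]) auto
      also have "\<dots> \<le> t * (1 - t) * (\<epsilon> * norm d)"
        using t by (intro mult_left_mono \<delta>(2) d) auto
      finally show "defect \<psi> t d x \<le> \<epsilon> * (t * (1 - t) * norm d)" by (simp add: mult_ac)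
    qed simp
    with \<delta>(1) show ?thesis by blast
  qed
  define upper where "upper y x = f y + G y (x - y) + \<psi> (x - y)" for y x
  define lower where "lower y x = f y + G y (x - y) - \<psi> (x - y)" for y x
  have lower_le_upper: "lower y x \<le> upper z x" if "y \<in> E" "z \<in> E" for x y z
    using compat[OF that] by (simp add: lower_def upper_def)
  define g where "g x = (INF y\<in>E. upper y x)" for x
  have bdd_upper: "bdd_below ((\<lambda>y. upper y x) ` E)" for x
  proof -
    obtain y where "y \<in> E" using E by blast
    then show ?thesis using lower_le_upper by (intro bdd_belowI2[of E "lower y x"])
  qed
  have g_le: "g x \<le> upper y x" if "y \<in> E" for x y
    unfolding g_def by (intro cINF_lower bdd_upper that)
  have le_g: "b \<le> g x" if "\<And>y. y \<in> E \<Longrightarrow> b \<le> upper y x" for b x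
    unfolding g_def by (intro cINF_greatest E that)
  have lower_le_g: "lower y x \<le> g x" if "y \<in> E" for x y
    using that lower_le_upper by (intro le_g) auto
  have lower_semiconvex: "semiconvex c (lower y)" for y
    unfolding semiconvex_def
  proof (intro ballI allI)
    fix t :: real and d x assume t: "t \<in> {0..1}"
    have "defect (lower y) t d x = - defect \<psi> t d (x - y)"
      by (simp add: lower_def defect_def blinfun.bilinear_simps algebra_simps)
    then show "- c t d \<le> defect (lower y) t d x" using defect_c[of t d "x - y"] t by simp
  qed
  obtain y0 where y0: "y0 \<in> E" using E by blast
  note h0 = lower_semiconvex[of y0] lower_le_g[OF y0]
  have defect_g: "defect g t d x \<le> c t d" if t: "0 \<le> t" "t \<le> 1" for t d x
  proof -
    have "t * g (x + (1 - t) *\<^sub>R d) + (1 - t) * g (x - t *\<^sub>R d) - c t d \<le> g x"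
    proof (rule le_g)
      fix y assume y: "y \<in> E"
      have "t * g (x + (1 - t) *\<^sub>R d) + (1 - t) * g (x - t *\<^sub>R d)
          \<le> t * upper y (x + (1 - t) *\<^sub>R d) + (1 - t) * upper y (x - t *\<^sub>R d)"
        using t by (intro add_mono mult_left_mono g_le y) auto
      also have "\<dots> = upper y x + defect \<psi> t d (x - y)"
        by (simp add: upper_def defect_def blinfun.bilinear_simps algebra_simps)
      finally show "t * g (x + (1 - t) *\<^sub>R d) + (1 - t) * g (x - t *\<^sub>R d) - c t d \<le> upper y x"
        using defect_c[OF t, of d "x - y"] by linarith
    qed
    then show ?thesis by (simp add: defect_def)
  qed
  have g_lip: "(M + K)-lipschitz_on UNIV g"
  proof -
    have *: "g x \<le> g z + (M + K) * norm (x - z)" for x z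
    proof -
      have "g x - (M + K) * norm (x - z) \<le> g z"
      proof (rule le_g)
        fix y assume y: "y \<in> E"
        have "\<bar>G y (x - z)\<bar> \<le> M * norm (x - z)"
          using order_trans[OF norm_blinfun mult_right_mono[OF M(2)[OF y]]] by simp
        moreover have "\<psi> (x - y) - \<psi> (z - y) \<le> K * norm (x - z)" using \<psi>_lip[of "x - y" "z - y"] by simp
        moreover have "upper y x - upper y z = G y (x - z) + (\<psi> (x - y) - \<psi> (z - y))"
          by (simp add: upper_def blinfun.bilinear_simps)
        ultimately have "upper y x \<le> upper y z + (M + K) * norm (x - z)" by (simp add: algebra_simps)
        with g_le[OF y, of x] show "g x - (M + K) * norm (x - z) \<le> upper y z" by simp
      qed
      then show ?thesis by simp
    qed
    show ?thesis
    proof (rule lipschitz_onI)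
      show "dist (g x) (g y) \<le> (M + K) * dist x y" for x y
        using *[of x y] *[of y x] by (simp add: dist_norm norm_minus_commute abs_le_iff)
    qed (use M K in simp)
  qed
  define F where "F = envelope c g"
  have F_lip: "(M + K)-lipschitz_on UNIV F"
    unfolding F_def by (rule lipschitz_envelope[OF h0 g_lip])
  have F_defect: "\<bar>defect F t d x\<bar> \<le> c t d" if t: "t \<in> {0..1}" for t d x
  proof -
    have "- c t d \<le> defect F t d x"
      using semiconvex_envelope[OF h0] t unfolding F_def semiconvex_def by blast
    moreover have "defect F t d x \<le> c t d"
      unfolding F_def using t by (intro defect_envelope_le[OF h0] defect_g) auto
    ultimately show ?thesis by simp
  qed
  have F_C1: "F \<in> C1plus UNIV"
  proof (rule C1plus_if_small_defects[OF F_lip])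
    fix \<epsilon> :: real assume "\<epsilon> > 0"
    from c_small[OF this] F_defect
    show "\<exists>\<delta>>0. \<forall>t\<in>{0..1}. \<forall>d x. norm d < \<delta> \<longrightarrow> \<bar>defect F t d x\<bar> \<le> \<epsilon> * (t * (1 - t) * norm d)"
      by (meson order_trans)
  qed
  have F_between: "lower y x \<le> F x" "F x \<le> upper y x" if "y \<in> E" for x y
  proof -
    show "lower y x \<le> F x"
      unfolding F_def by (intro semiconvex_le_envelope lower_semiconvex lower_le_g that)
    show "F x \<le> upper y x"
      using envelope_le[OF h0, of x] g_le[OF that, of x] by (simp add: F_def)
  qed
  have F_f: "F y = f y" if "y \<in> E" for y
    using F_between[OF that, of y] \<psi>(1) by (simp add: lower_def upper_def)
  have "DF F y = G y" if y: "y \<in> E" for y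
  proof -
    have "(F has_derivative G y) (at y)"
      unfolding has_derivative_at_alt
    proof (intro conjI allI impI)
      fix e :: real assume "e > 0"
      from smooth[OF this] obtain \<delta> where \<delta>: "\<delta> > 0"
        "\<And>x h. norm h < \<delta> \<Longrightarrow> \<psi> (x + h) + \<psi> (x - h) - 2 * \<psi> x \<le> e * norm h" by blast
      have "norm (F x - F y - G y (x - y)) \<le> e * norm (x - y)" if "norm (x - y) < \<delta>" for x
      proof -
        have "\<psi> (x - y) \<le> e * norm (x - y)"
          using \<delta>(2)[OF that, of 0] \<psi>(1) \<psi>(2)[of "y - x"] by simp
        then show ?thesis
          using F_between[OF y, of x] F_f[OF y] by (simp add: lower_def upper_def abs_le_iff)
      qed
      with \<delta>(1) show "\<exists>d>0. \<forall>x. norm (x - y) < d \<longrightarrow> norm (F x - F y - G y (x - y)) \<le> e * norm (x - y)"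
        by blast
    qed (rule blinfun.bounded_linear_right)
    then show ?thesis
      by (simp add: DF_def frechet_derivative_at[symmetric] blinfun_apply_inverse)
  qed
  with F_f F_lip F_C1 show ?thesis by (intro that) auto
qed

lemma Whitney_extension:
  fixes E :: "'a::banach set" and f :: "'a \<Rightarrow> real" and G :: "'a \<Rightarrow> 'a \<Rightarrow>\<^sub>L real"
  assumes sr: "super_reflexive TYPE('a)"
    and f: "L-lipschitz_on E f" and G: "bounded (G ` E)" and W: "condition_W E f G"
  shows "\<exists>F. (\<forall>x\<in>E. F x = f x) \<and> (\<exists>L. L-lipschitz_on UNIV F) \<and> F \<in> C1plus UNIV \<and> (\<forall>x\<in>E. DF F x = G x)"
proof (cases "E = {}")
  case True
  \<comment> \<open>There are no barriers, and an infimum over the empty set would carry no information.\<close>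
  have "(\<lambda>x::'a. 0::real) \<in> C1plus UNIV"
    by (rule C1plus_if_uniform_Taylor[of _ "\<lambda>_. 0"]) (auto intro: exI[of _ 1])
  moreover have "0-lipschitz_on UNIV (\<lambda>x::'a. 0::real)" by (rule lipschitz_on_constant)
  ultimately show ?thesis using True by blast
next
  case False
  obtain \<psi> :: "'a \<Rightarrow> real" and K where \<psi>: "smooth_convex_gauge \<psi> K"
    "\<And>x y z. y \<in> E \<Longrightarrow> z \<in> E \<Longrightarrow> f y + G y (x - y) - \<psi> (x - y) \<le> f z + G z (x - z) + \<psi> (x - z)"
    by (rule gauge_separates_jets[OF sr f G W]) (use that in blast)
  obtain F B where "\<And>x. x \<in> E \<Longrightarrow> F x = f x" "B-lipschitz_on UNIV F" "F \<in> C1plus UNIV"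
    "\<And>x. x \<in> E \<Longrightarrow> DF F x = G x"
    by (rule extension_of_separated_jets[OF False G \<psi>]) (use that in blast)+
  then show ?thesis by blast
qed

theorem theorem54:
  fixes E :: "'a::banach set" and f :: "'a \<Rightarrow> real"
  assumes "super_reflexive TYPE('a)"
  shows "let
      i = (\<lambda>G. bounded (f ` E) \<and> bounded (G ` E) \<and> condition_W E f G);
      ii = (\<lambda>G. (\<exists>L. L-lipschitz_on E f) \<and> bounded (G ` E) \<and> condition_W E f G);
      iii = (\<lambda>F. (\<forall>x\<in>E. F x = f x) \<and> (\<exists>L. L-lipschitz_on UNIV F) \<and> F \<in> C1plus UNIV);
      iv = (\<lambda>F. (\<forall>x\<in>E. F x = f x) \<and> F \<in> C1plus UNIV)
    in
      ((\<exists>G. i G) \<longrightarrow> (\<exists>G. ii G)) \<and>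
      ((\<exists>G. ii G) \<longleftrightarrow> (\<exists>F. iii F)) \<and>
      ((\<exists>F. iii F) \<longrightarrow> (\<exists>F. iv F)) \<and>
      (bounded E \<longrightarrow>
        ((\<exists>G. i G) \<longleftrightarrow> (\<exists>G. ii G)) \<and>
        ((\<exists>G. ii G) \<longleftrightarrow> (\<exists>F. iii F)) \<and>
        ((\<exists>F. iii F) \<longleftrightarrow> (\<exists>F. iv F))) \<and>
      (\<forall>G. i G \<or> ii G \<longrightarrow>
        (\<exists>F. iii F \<and> (\<forall>x\<in>E. DF F x = G x)) \<and>
        (\<exists>F. iv F \<and> (\<forall>x\<in>E. DF F x = G x)))"
proof -
  define i where "i = (\<lambda>G. bounded (f ` E) \<and> bounded (G ` E) \<and> condition_W E f G)"
  define ii where "ii = (\<lambda>G. (\<exists>L. L-lipschitz_on E f) \<and> bounded (G ` E) \<and> condition_W E f G)"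
  define iii where "iii = (\<lambda>F. (\<forall>x\<in>E. F x = f x) \<and> (\<exists>L. L-lipschitz_on UNIV F) \<and> F \<in> C1plus UNIV)"
  define iv where "iv = (\<lambda>F. (\<forall>x\<in>E. F x = f x) \<and> F \<in> C1plus UNIV)"
  have i_ii: "ii G" if "i G" for G
    using that bounded_condition_W_imp_lipschitz unfolding i_def ii_def by blast
  have extend: "\<exists>F. iii F \<and> (\<forall>x\<in>E. DF F x = G x)" if "ii G" for G
    using that Whitney_extension[OF assms] unfolding ii_def iii_def by blast
  have W: "condition_W E f (DF F)" if "iv F" for F
    using that condition_W_subset[OF C1plus_condition_W subset_UNIV] unfolding iv_def by blast
  have iii_iv: "iv F" if "iii F" for F
    using that unfolding iii_def iv_def by blast
  have iii_ii: "ii (DF F)" if "iii F" for F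
  proof -
    obtain L where F: "\<And>x. x \<in> E \<Longrightarrow> F x = f x" "L-lipschitz_on UNIV F" "F \<in> C1plus UNIV"
      using \<open>iii F\<close> by (auto simp: iii_def)
    have "L-lipschitz_on E f"
      using lipschitz_on_subset[OF F(2) subset_UNIV] F(1)[symmetric] by (rule lipschitz_on_transform)
    moreover have "bounded (DF F ` E)"
      by (rule bounded_subset[OF C1plus_lipschitz_imp_bounded_DF[OF F(3,2)]]) auto
    ultimately show ?thesis using W[OF iii_iv[OF that]] by (auto simp: ii_def)
  qed
  have iv_ii: "ii (DF F)" if iv: "iv F" and E: "bounded E" for F
  proof -
    have F: "\<And>x. x \<in> E \<Longrightarrow> F x = f x" "F \<in> C1plus UNIV" using iv by (auto simp: iv_def)
    obtain L where "L-lipschitz_on E F" using C1plus_on_bounded_set(2)[OF F(2) E] by blast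
    then have "L-lipschitz_on E f" using F(1)[symmetric] by (rule lipschitz_on_transform)
    then show ?thesis
      using W[OF iv] C1plus_on_bounded_set(1)[OF F(2) E] by (auto simp: ii_def)
  qed
  have ii_i: "i G" if G: "ii G" and E: "bounded E" for G
  proof -
    obtain L where L: "L-lipschitz_on E f" using G by (auto simp: ii_def)
    obtain B where B: "\<And>x y. x \<in> E \<Longrightarrow> y \<in> E \<Longrightarrow> dist x y \<le> B"
      using E by (auto simp: bounded_two_points)
    have "dist (f x) (f y) \<le> L * B" if "x \<in> E" "y \<in> E" for x y
      using lipschitz_onD[OF L that] mult_left_mono[OF B[OF that] lipschitz_on_nonneg[OF L]] by linarith
    then have "bounded (f ` E)" by (auto simp: bounded_two_points)
    then show ?thesis using G by (simp add: i_def ii_def)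
  qed
  have "((\<exists>G. i G) \<longrightarrow> (\<exists>G. ii G)) \<and>
      ((\<exists>G. ii G) \<longleftrightarrow> (\<exists>F. iii F)) \<and>
      ((\<exists>F. iii F) \<longrightarrow> (\<exists>F. iv F)) \<and>
      (bounded E \<longrightarrow>
        ((\<exists>G. i G) \<longleftrightarrow> (\<exists>G. ii G)) \<and>
        ((\<exists>G. ii G) \<longleftrightarrow> (\<exists>F. iii F)) \<and>
        ((\<exists>F. iii F) \<longleftrightarrow> (\<exists>F. iv F))) \<and>
      (\<forall>G. i G \<or> ii G \<longrightarrow>
        (\<exists>F. iii F \<and> (\<forall>x\<in>E. DF F x = G x)) \<and>
        (\<exists>F. iv F \<and> (\<forall>x\<in>E. DF F x = G x)))"
    using i_ii extend iii_iv iii_ii iv_ii ii_i by meson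
  then show ?thesis
    unfolding Let_def i_def ii_def iii_def iv_def .
qed

end
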